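(* Let $T_i x = A_i x + d_i$ ($1\le i\le m$) be affine maps of $\mathbb R^2$, where the $A_i$ are invertible $2\times 2$ real matrices with all entries strictly positive and $\|A_i\|_2<1$, and $d_i\in\mathbb R^2$. Let $E$ be the attractor of the IFS $\{T_1,\dots,T_m\}$ and assume the strong separation condition, i.e. the sets $T_1(E),\dots,T_m(E)$ are pairwise disjoint. Let $J$ be the minimal (non-empty) closed interval in $\mathcal Q_2$ such that $\phi_i(J)\subset J$ for all $i=1,\dots,m$, and let $$S=\{\widehat{x-y}: x\in T_i(E),\ y\in T_j(E),\ i\ne j\}\subset\mathbb{RP}^1 .$$ If $J$ and $S$ are disjoint, then $E$ is contained in a Lipschitz curve and $$\dim_H E=\dim_B E=\dim_A(A_1,\dots,A_m).$$
   Context: The attractor $E$ is the unique non-empty compact set with $E=\bigcup_{i=1}^m T_i(E)$. $\mathbb{RP}^1$ is the set of directions (unit vectors up to sign) in $\mathbb R^2$; $\widehat w\in\mathbb{RP}^1$ denotes the direction of a non-zero vector $w$; $\mathcal Q_2\subset\mathbb{RP}^1$ is the interval of directions of non-zero vectors $(x,y)$ with $xy\le0$. The map $\phi_i:\mathbb{RP}^1\to\mathbb{RP}^1$ is $\phi_i(\theta)=A_i^{-1}\theta/\|A_i^{-1}\theta\|$; since $A_i$ is strictly positive, $\phi_i$ maps $\mathcal Q_2$ into itself. For a matrix $A$ with singular values $\alpha_1\ge\alpha_2>0$ put $\phi^s(A)=\alpha_1^s$ for $0<s\le 1$ and $\phi^s(A)=\alpha_1\alpha_2^{s-1}$ for $s\ge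 1$. The affinity dimension is $\dim_A(A_1,\dots,A_m)=\inf\{s>0:\sum_{n\ge1}\sum_{a_1\cdots a_n\in\{1,\dots,m\}^n}\phi^s(A_{a_1}\cdots A_{a_n})<\infty\}$. $\dim_H,\dim_B$ denote Hausdorff and box-counting dimension (existence of $\dim_B E$ is part of the conclusion). A Lipschitz curve here means the graph of a Lipschitz function over a line in some direction in $\mathbb R^2$. *)

theory Defs
  imports "HOL-Analysis.Analysis"
begin

subsection \<open>Directions in the plane\<close>

text \<open>A point of the projective line is the set \<open>{u, -u}\<close> for a unit vector \<open>u\<close>.\<close>

definition direction :: "real^2 \<Rightarrow> (real^2) set" where
  "direction w = {sgn w, - sgn w}"

definition Q2 :: "(real^2) set set" where
  "Q2 = {direction w | w. w \<noteq> 0 \<and> w $ 1 * w $ 2 \<le> 0}"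

text \<open>Closed intervals of directions, parametrized by the angle; a single direction is allowed
  (for one matrix, the minimal invariant interval is a point).\<close>

definition closed_interval_RP1 :: "(real^2) set set \<Rightarrow> bool" where
  "closed_interval_RP1 K \<longleftrightarrow>
     (\<exists>a b. a \<le> b \<and> b < a + pi \<and> K = (\<lambda>t. direction (vector [cos t, sin t])) ` {a..b})"

definition inv_action :: "real^2^2 \<Rightarrow> (real^2) set \<Rightarrow> (real^2) set" where
  "inv_action A \<theta> = (\<lambda>u. (matrix_inv A *v u) /\<^sub>R norm (matrix_inv A *v u)) ` \<theta>"

definition invariant_interval :: "nat \<Rightarrow> (nat \<Rightarrow> real^2^2) \<Rightarrow> (real^2) set set \<Rightarrow> bool" where
  "invariant_interval m A K \<longleftrightarrow>
     closed_interval_RP1 K \<and> K \<subseteq> Q2 \<and> (\<forall>i\<in>{1..m}. inv_action (A i) ` K \<subseteq> K)"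

definition minimal_invariant_interval :: "nat \<Rightarrow> (nat \<Rightarrow> real^2^2) \<Rightarrow> (real^2) set set \<Rightarrow> bool" where
  "minimal_invariant_interval m A J \<longleftrightarrow>
     invariant_interval m A J \<and> (\<forall>K. invariant_interval m A K \<and> K \<subseteq> J \<longrightarrow> K = J)"

lemma inv_action_direction:
  assumes "w \<noteq> 0"
  shows "inv_action A (direction w) = direction (matrix_inv A *v w)"
proof -
  have eq: "(matrix_inv A *v (c *\<^sub>R w)) = c *\<^sub>R (matrix_inv A *v w)" for c
    by (simp add: matrix_vector_mult_scaleR)
  show ?thesis
    using assms eq[of "inverse (norm w)"] eq[of "- inverse (norm w)"]
    unfolding inv_action_def direction_def sgn_div_norm
    by (auto simp: divide_inverse)
qed


subsection \<open>Attractors\<close>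

definition is_attractor :: "nat \<Rightarrow> (nat \<Rightarrow> real^2 \<Rightarrow> real^2) \<Rightarrow> (real^2) set \<Rightarrow> bool" where
  "is_attractor m T E \<longleftrightarrow> E \<noteq> {} \<and> compact E \<and> E = (\<Union>i\<in>{1..m}. T i ` E)"

definition difference_directions ::
    "nat \<Rightarrow> (nat \<Rightarrow> real^2 \<Rightarrow> real^2) \<Rightarrow> (real^2) set \<Rightarrow> (real^2) set set" where
  "difference_directions m T E =
     {direction (x - y) | x y i j.
        i \<in> {1..m} \<and> j \<in> {1..m} \<and> i \<noteq> j \<and> x \<in> T i ` E \<and> y \<in> T j ` E}"

definition lipschitz_curve :: "(real^2) set \<Rightarrow> bool" where
  "lipschitz_curve C \<longleftrightarrow>
     (\<exists>u v :: real^2. \<exists>f :: real \<Rightarrow> real. \<exists>L. norm u = 1 \<and> norm v = 1 \<and> u \<bullet> v = 0 \<and>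
        L-lipschitz_on UNIV f \<and> C = range (\<lambda>t. t *\<^sub>R u + f t *\<^sub>R v))"


subsection \<open>Affinity dimension\<close>

definition singular_values :: "real^2^2 \<Rightarrow> real set" where
  "singular_values A =
     {sqrt l | l. \<exists>v. v \<noteq> 0 \<and> (transpose A ** A) *v v = l *\<^sub>R v}"

text \<open>A \<open>2 \<times> 2\<close> matrix has two singular values counted with multiplicity, so the larger and the
  smaller one are the maximum and the minimum of the set (and agree if it is a singleton).\<close>

definition alpha1 :: "real^2^2 \<Rightarrow> real" where
  "alpha1 A = Max (singular_values A)"

definition alpha2 :: "real^2^2 \<Rightarrow> real" where
  "alpha2 A = Min (singular_values A)"

definition sv_function :: "real \<Rightarrow> real^2^2 \<Rightarrow> real" where
  "sv_function s A =
     (if s \<le> 1 then alpha1 A powr s else alpha1 A * alpha2 A powr (s - 1))"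

definition words :: "nat \<Rightarrow> nat \<Rightarrow> nat list set" where
  "words m n = {w. length w = n \<and> set w \<subseteq> {1..m}}"

definition word_product :: "(nat \<Rightarrow> real^2^2) \<Rightarrow> nat list \<Rightarrow> real^2^2" where
  "word_product A w = foldr (\<lambda>i M. A i ** M) w (mat 1)"

definition affinity_dim :: "nat \<Rightarrow> (nat \<Rightarrow> real^2^2) \<Rightarrow> ereal" where
  "affinity_dim m A =
     (INF s \<in> {s. 0 < s \<and>
        (\<Sum>n. \<Sum>w\<in>words m (Suc n). ennreal (sv_function s (word_product A w))) < \<infinity>}. ereal s)"


subsection \<open>Hausdorff and box-counting dimension\<close>

text \<open>Covers are required to consist of bounded sets because \<^const>\<open>diameter\<close> is meaningless on
  unbounded ones.\<close>

definition hausdorff_premeasure :: "real \<Rightarrow> real \<Rightarrow> 'a::metric_space set \<Rightarrow> ennreal" where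
  "hausdorff_premeasure s \<delta> E =
     (INF U \<in> {U :: nat \<Rightarrow> 'a set. E \<subseteq> (\<Union>n. U n) \<and> (\<forall>n. bounded (U n) \<and> diameter (U n) \<le> \<delta>)}.
        \<Sum>n. ennreal (diameter (U n) powr s))"

definition hausdorff_measure :: "real \<Rightarrow> 'a::metric_space set \<Rightarrow> ennreal" where
  "hausdorff_measure s E = (SUP \<delta> \<in> {0<..}. hausdorff_premeasure s \<delta> E)"

text \<open>Restricting to \<open>s > 0\<close> does not change the infimum and avoids \<open>0 powr 0 = 0\<close>.\<close>

definition hausdorff_dim :: "'a::metric_space set \<Rightarrow> ereal" where
  "hausdorff_dim E = (INF s \<in> {s. 0 < s \<and> hausdorff_measure s E = 0}. ereal s)"

text \<open>Least number of sets of diameter at most \<open>\<delta>\<close> covering \<open>E\<close>; meaningful for totally bounded \<open>E\<close>.\<close>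

definition covering_number :: "real \<Rightarrow> 'a::metric_space set \<Rightarrow> nat" where
  "covering_number \<delta> E =
     (LEAST k. \<exists>F. finite F \<and> card F = k \<and> E \<subseteq> \<Union>F \<and> (\<forall>U\<in>F. bounded U \<and> diameter U \<le> \<delta>))"

text \<open>The box-counting dimension of \<open>E\<close> exists and equals \<open>d\<close>.\<close>

definition has_box_dim :: "'a::metric_space set \<Rightarrow> ereal \<Rightarrow> bool" where
  "has_box_dim E d \<longleftrightarrow>
     ((\<lambda>\<delta>. ereal (ln (real (covering_number \<delta> E)) / - ln \<delta>)) \<longlongrightarrow> d) (at_right 0)"

end

theory Submission
  imports Defs "HOL-Real_Asymp.Real_Asymp"
begin

text \<open>
  Let \<open>N\<close> be the sum of the entries of a matrix; on positive matrices it is submultiplicative and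
  comparable to the largest singular value. Take the functionals \<open>l0, l1\<close> with nonnegative entries
  that vanish on the two endpoint directions of \<open>J\<close>. Invariance of \<open>J\<close> under the inverses
  of the \<open>A i\<close> means that \<open>l \<mapsto> l \<circ> A i\<close> preserves the cone spanned by \<open>l0\<close> and \<open>l1\<close>, and disjointness of \<open>J\<close>
  from the difference directions says that \<open>l0\<close> and \<open>l1\<close> have the same strict sign on every difference
  \<open>u\<close> of points from distinct pieces. By compactness \<open>\<bar>(l0 + l1) (A\<^sub>w u)\<bar> \<ge> c N(A\<^sub>w)\<close> for all words
  \<open>w\<close> and all such \<open>u\<close>. Every difference of two points of \<open>E\<close> has the form \<open>A\<^sub>w u\<close>, so the
  functional \<open>l0 + l1\<close> is bi-Lipschitz on \<open>E\<close>, which gives the Lipschitz curve, and \<open>E\<close> behaves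
  like a self-similar set with contraction ratios \<open>N(A\<^sub>w)\<close>. Counting stopping words bounds the box
  dimension from above. If \<open>E\<close> has \<open>t\<close>-dimensional Hausdorff measure zero, it is covered by finitely many
  cylinders with \<open>\<Sum> N(A\<^sub>w)\<^sup>t \<le> 1/2\<close>; every long word starts with one of these words, and the
  resulting renewal inequality bounds \<open>\<Sum> N(A\<^sub>w)\<^sup>t\<close> over all words.
\<close>

subsection \<open>Positive matrices and singular values\<close>

text \<open>On nonnegative matrices this is the entrywise l1 norm; being linear in the entries, it
  is as easy to bound from below as from above.\<close>

definition entry_sum :: "real^2^2 \<Rightarrow> real" where
  "entry_sum M = M$1$1 + M$1$2 + M$2$1 + M$2$2"

definition nonneg_mat :: "real^2^2 \<Rightarrow> bool" where
  "nonneg_mat M \<longleftrightarrow> (\<forall>i j. 0 \<le> M$i$j)"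

definition ones :: "real^2" where
  "ones = (\<chi> i. 1)"

lemma mult_vec_2: "((M::real^2^2) *v x) $ i = M$i$1 * x$1 + M$i$2 * x$2"
  by (simp add: matrix_vector_mult_def sum_2)

lemma mult_mat_2: "((M::real^2^2) ** P) $ i $ j = M$i$1 * P$1$j + M$i$2 * P$2$j"
  by (simp add: matrix_matrix_mult_def sum_2)

lemma nonneg_mat_mult: "nonneg_mat M \<Longrightarrow> nonneg_mat P \<Longrightarrow> nonneg_mat (M ** P)"
  by (simp add: nonneg_mat_def mult_mat_2)

lemma entry_sum_nonneg: "nonneg_mat M \<Longrightarrow> 0 \<le> entry_sum M"
  by (simp add: nonneg_mat_def entry_sum_def)

text \<open>The product of the two sums contains every product of an entry of \<open>M\<close> with
  an entry of \<open>P\<close>; the matrix product keeps those with matching inner index, and the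
  discarded ones are nonnegative.\<close>

lemma entry_sum_mult_le:
  assumes "nonneg_mat M" "nonneg_mat P"
  shows "entry_sum (M ** P) \<le> entry_sum M * entry_sum P"
proof -
  have nn: "0 \<le> M$i$j" "0 \<le> P$i$j" for i j
    using assms by (auto simp: nonneg_mat_def)
  have "entry_sum M * entry_sum P - entry_sum (M ** P) =
      (M$1$1 + M$2$1) * (P$2$1 + P$2$2) + (M$1$2 + M$2$2) * (P$1$1 + P$1$2)"
    by (simp add: entry_sum_def mult_mat_2 algebra_simps)
  moreover have "\<dots> \<ge> 0"
    using nn by (intro add_nonneg_nonneg mult_nonneg_nonneg) auto
  ultimately show ?thesis by linarith
qed

lemma norm_vec2_sq: "(norm (x::real^2))\<^sup>2 = (x$1)\<^sup>2 + (x$2)\<^sup>2"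
  by (simp add: norm_vec_def L2_set_def sum_2)

lemma inner_vec2: "(x::real^2) \<bullet> y = x$1 * y$1 + x$2 * y$2"
  by (simp add: inner_vec_def sum_2)

lemma norm_mult_le_entry_sum:
  assumes "nonneg_mat M"
  shows "norm (M *v x) \<le> entry_sum M * norm x"
proof -
  have nn: "0 \<le> M$i$j" for i j
    using assms by (auto simp: nonneg_mat_def)
  have c: "\<bar>x$i\<bar> \<le> norm x" for i
    by (simp add: component_le_norm_cart)
  have row: "\<bar>(M *v x)$i\<bar> \<le> (M$i$1 + M$i$2) * norm x" for i
  proof -
    have "\<bar>(M *v x)$i\<bar> \<le> \<bar>M$i$1 * x$1\<bar> + \<bar>M$i$2 * x$2\<bar>"
      unfolding mult_vec_2 by (rule abs_triangle_ineq)
    also have "\<dots> \<le> M$i$1 * norm x + M$i$2 * norm x"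
      using nn c by (simp add: abs_mult add_mono mult_left_mono)
    finally show ?thesis by (simp add: algebra_simps)
  qed
  have "norm (M *v x) \<le> \<bar>(M *v x)$1\<bar> + \<bar>(M *v x)$2\<bar>"
    using norm_le_l1_cart[of "M *v x"] by (simp add: sum_2)
  also have "\<dots> \<le> (M$1$1 + M$1$2) * norm x + (M$2$1 + M$2$2) * norm x"
    by (intro add_mono row)
  finally show ?thesis by (simp add: entry_sum_def algebra_simps)
qed

text \<open>Serves to turn a bound on the operator norm into one on the entry sum.\<close>

lemma entry_sum_le_norm_ones: "entry_sum M \<le> 2 * norm (M *v ones)"
proof -
  have "entry_sum M = (M *v ones) $ 1 + (M *v ones) $ 2"
    by (simp add: entry_sum_def mult_vec_2 ones_def)
  also have "\<dots> \<le> norm (M *v ones) + norm (M *v ones)"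
    using component_le_norm_cart[of "M *v ones"] by (intro add_mono) (metis abs_ge_self order_trans)+
  finally show ?thesis by simp
qed

text \<open>Eigenvalues are roots of the characteristic polynomial. Finiteness is what makes
  \<open>Max\<close> and \<open>Min\<close> in \<open>alpha1\<close> and \<open>alpha2\<close>
  meaningful.\<close>

lemma eigenvalues_finite:
  fixes B :: "real^2^2"
  shows "finite {l. \<exists>v. v \<noteq> 0 \<and> B *v v = l *\<^sub>R v}"
proof (rule finite_subset)
  let ?p = "[:B$1$1 * B$2$2 - B$1$2 * B$2$1, - (B$1$1 + B$2$2), 1:]"
  show "finite {l. poly ?p l = 0}"
    by (rule poly_roots_finite) auto
  show "{l. \<exists>v. v \<noteq> 0 \<and> B *v v = l *\<^sub>R v} \<subseteq> {l. poly ?p l = 0}"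
  proof clarify
    fix l and v :: "real^2"
    assume v: "v \<noteq> 0" "B *v v = l *\<^sub>R v"
    have eq: "B$i$1 * v$1 + B$i$2 * v$2 = l * v$i" for i
      using arg_cong[OF v(2), of "\<lambda>x. x $ i"] by (simp add: mult_vec_2)
    have "poly ?p l * v$1 = 0" "poly ?p l * v$2 = 0"
      using eq[of 1] eq[of 2] by (simp; algebra)+
    then show "poly ?p l = 0"
      using v(1) by (auto simp: vec_eq_iff forall_2)
  qed
qed

lemma singular_values_finite: "finite (singular_values M)"
proof -
  have "singular_values M = sqrt ` {l. \<exists>v. v \<noteq> 0 \<and> (transpose M ** M) *v v = l *\<^sub>R v}"
    unfolding singular_values_def by auto
  then show ?thesis
    using eigenvalues_finite by simp
qed

text \<open>If \<open>v\<close> is an eigenvector of the Gram matrix with eigenvalue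
  \<open>l\<close>, then \<open>M\<close> stretches \<open>v\<close> by exactly
  \<open>sqrt l\<close>, which therefore cannot exceed the operator norm.\<close>

lemma singular_value_bounds:
  assumes "nonneg_mat M" "r \<in> singular_values M"
  shows "0 \<le> r" "r \<le> entry_sum M"
proof -
  obtain l v where lv: "r = sqrt l" "v \<noteq> 0" "(transpose M ** M) *v v = l *\<^sub>R v"
    using assms(2) unfolding singular_values_def by auto
  have "(norm (M *v v))\<^sup>2 = (M *v v) \<bullet> (M *v v)"
    by (simp add: power2_norm_eq_inner)
  also have "\<dots> = v \<bullet> ((transpose M ** M) *v v)"
    by (metis dot_lmul_matrix transpose_matrix_vector matrix_vector_mul_assoc inner_commute)
  also have "\<dots> = l * (norm v)\<^sup>2"
    by (simp add: lv power2_norm_eq_inner)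
  finally have e: "(norm (M *v v))\<^sup>2 = l * (norm v)\<^sup>2" .
  have nv: "norm v > 0" using lv by simp
  have l0: "0 \<le> l"
    using e nv by (metis zero_le_power2 zero_le_mult_iff not_less zero_less_power)
  then show "0 \<le> r" using lv by simp
  have "l * (norm v)\<^sup>2 \<le> (entry_sum M * norm v)\<^sup>2"
    unfolding e[symmetric] by (intro power_mono norm_mult_le_entry_sum assms) auto
  then have "l \<le> (entry_sum M)\<^sup>2"
    using nv by (simp add: power_mult_distrib)
  then show "r \<le> entry_sum M"
    using lv entry_sum_nonneg[OF assms(1)] by (simp add: real_le_lsqrt)
qed

text \<open>The larger root of the characteristic polynomial of the Gram matrix is at least half its
  trace, which is the sum of the squared entries.\<close>

lemma large_singular_value_exists:
  assumes "\<And>i j. 0 < M$i$j"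
  shows "\<exists>r\<in>singular_values M. entry_sum M / 4 \<le> r"
proof -
  define p q s where "p = (M$1$1)\<^sup>2 + (M$2$1)\<^sup>2"
    and "q = M$1$1 * M$1$2 + M$2$1 * M$2$2" and "s = (M$1$2)\<^sup>2 + (M$2$2)\<^sup>2"
  have q: "q > 0" unfolding q_def by (simp add: assms add_pos_pos)
  \<comment> \<open>\<open>D\<close> is the square root of the discriminant of the characteristic
    polynomial of the Gram matrix, so \<open>l\<close> below is its larger root.\<close>
  define D where "D = sqrt ((p - s)\<^sup>2 + 4 * q\<^sup>2)"
  have D2: "D\<^sup>2 = (p - s)\<^sup>2 + 4 * q\<^sup>2" "D \<ge> 0"
    unfolding D_def by (auto simp: real_sqrt_pow2)
  define l where "l = (p + s + D) / 2"
  have char: "q * q = (l - p) * (l - s)"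
    using D2 unfolding l_def by (simp add: field_simps power2_eq_square)
  define v :: "real^2" where "v = vector [q, l - p]"
  have v0: "v \<noteq> 0"
    using q by (auto simp: v_def vec_eq_iff forall_2 vector_2)
  have gram: "(transpose M ** M)$1$1 = p" "(transpose M ** M)$1$2 = q"
     "(transpose M ** M)$2$1 = q" "(transpose M ** M)$2$2 = s"
    by (simp_all add: mult_mat_2 transpose_def p_def q_def s_def power2_eq_square algebra_simps)
  have "(transpose M ** M) *v v = l *\<^sub>R v"
    using char unfolding vec_eq_iff forall_2 mult_vec_2 gram
    by (simp add: v_def vector_2 algebra_simps)
  then have mem: "sqrt l \<in> singular_values M"
    unfolding singular_values_def using v0 by auto
  have "(entry_sum M)\<^sup>2 \<le> 4 * (p + s)"
  proof -
    \<comment> \<open>Cauchy-Schwarz for four numbers, with the deficit written as the sum of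
      squared differences over all pairs.\<close>
    have "4 * (p + s) - (entry_sum M)\<^sup>2 =
       (M$1$1 - M$1$2)\<^sup>2 + (M$1$1 - M$2$1)\<^sup>2 + (M$1$1 - M$2$2)\<^sup>2 +
       (M$1$2 - M$2$1)\<^sup>2 + (M$1$2 - M$2$2)\<^sup>2 + (M$2$1 - M$2$2)\<^sup>2"
      unfolding p_def s_def entry_sum_def by (simp add: power2_eq_square algebra_simps)
    moreover have "\<dots> \<ge> 0" by simp
    ultimately show ?thesis by linarith
  qed
  moreover have "p + s \<le> 2 * l" using D2 by (simp add: l_def)
  moreover have "p + s \<ge> 0" by (simp add: p_def s_def)
  ultimately have "(entry_sum M / 4)\<^sup>2 \<le> l"
    by (simp add: power2_eq_square field_simps)
  then show ?thesis using mem real_le_rsqrt by blast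
qed

lemma alpha1_bounds:
  assumes "\<And>i j. 0 < M$i$j"
  shows "entry_sum M / 4 \<le> alpha1 M" "alpha1 M \<le> entry_sum M"
    and "0 \<le> alpha2 M" "alpha2 M \<le> entry_sum M"
proof -
  have nn: "nonneg_mat M" using assms by (simp add: nonneg_mat_def less_imp_le)
  obtain r where r: "r \<in> singular_values M" "entry_sum M / 4 \<le> r"
    using large_singular_value_exists[OF assms] by blast
  have ne: "singular_values M \<noteq> {}" using r by auto
  note fin = singular_values_finite[of M]
  show "entry_sum M / 4 \<le> alpha1 M"
    unfolding alpha1_def using Max_ge[OF fin r(1)] r(2) by linarith
  show "alpha1 M \<le> entry_sum M"
    unfolding alpha1_def using Max_in[OF fin ne] singular_value_bounds[OF nn] by blast
  show "0 \<le> alpha2 M" "alpha2 M \<le> entry_sum M"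
    unfolding alpha2_def using Min_in[OF fin ne] singular_value_bounds[OF nn] by blast+
qed

text \<open>For \<open>s > 1\<close> the smaller singular value is crudely bounded by the entry sum
  as well; this is enough to deduce convergence of the series for every \<open>s\<close>.\<close>

lemma sv_function_le:
  assumes "\<And>i j. 0 < M$i$j" "0 < s"
  shows "sv_function s M \<le> entry_sum M powr s"
proof (cases "s \<le> 1")
  case True
  have "0 < entry_sum M" unfolding entry_sum_def by (intro add_pos_pos assms)
  then show ?thesis
    using True alpha1_bounds[OF assms(1)] assms(2)
    by (auto simp: sv_function_def intro!: powr_mono2)
next
  case False
  have N: "0 < entry_sum M" unfolding entry_sum_def by (intro add_pos_pos assms)
  have "alpha1 M * alpha2 M powr (s - 1) \<le> entry_sum M * entry_sum M powr (s - 1)"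
    using False N alpha1_bounds[OF assms(1)] by (intro mult_mono powr_mono2) auto
  also have "\<dots> = entry_sum M powr s"
    using N by (simp add: powr_mult_base)
  finally show ?thesis using False by (simp add: sv_function_def)
qed

text \<open>Restricted to \<open>s \<le> 1\<close>: beyond that \<open>alpha2\<close> enters, which
  has no lower bound in terms of the entry sum.\<close>

lemma sv_function_ge:
  assumes "\<And>i j. 0 < M$i$j" "0 < s" "s \<le> 1"
  shows "(entry_sum M / 4) powr s \<le> sv_function s M"
proof -
  have "0 < entry_sum M" unfolding entry_sum_def by (intro add_pos_pos assms)
  then show ?thesis
    using assms alpha1_bounds[OF assms(1)]
    by (auto simp: sv_function_def intro!: powr_mono2)
qed

subsection \<open>Hausdorff and box-counting dimension of compact sets\<close>

lemma diameter_le_dist: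
  fixes S :: "'a::metric_space set"
  assumes "0 \<le> d" "\<And>x y. x \<in> S \<Longrightarrow> y \<in> S \<Longrightarrow> dist x y \<le> d"
  shows "diameter S \<le> d"
  unfolding diameter_def using assms by (auto intro!: cSUP_least)

lemma covering_number_le_card:
  assumes "finite F" "E \<subseteq> \<Union>F" "\<And>U. U \<in> F \<Longrightarrow> bounded U \<and> diameter U \<le> \<delta>"
  shows "covering_number \<delta> E \<le> card F"
  unfolding covering_number_def by (rule Least_le) (use assms in blast)

text \<open>Total boundedness supplies a finite cover by balls of radius \<open>\<delta>/2\<close>,
  so the \<open>LEAST\<close> in \<open>covering_number\<close> ranges over a nonempty set.\<close>

lemma covering_number_attained:
  fixes E :: "'a::metric_space set"
  assumes "compact E" "0 < \<delta>"
  shows "\<exists>F. finite F \<and> card F = covering_number \<delta> E \<and> E \<subseteq> \<Union>F \<and>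
             (\<forall>U\<in>F. bounded U \<and> diameter U \<le> \<delta>)"
proof -
  obtain k where k: "finite k" "E \<subseteq> (\<Union>x\<in>k. ball x (\<delta>/2))"
    using assms seq_compact_imp_totally_bounded[OF compact_imp_seq_compact[OF assms(1)]] by (meson half_gt_zero)
  have "diameter (ball x (\<delta>/2)) \<le> \<delta>" for x :: 'a
    using assms(2) dist_triangle_half_r[of x _ \<delta>]
    by (intro diameter_le_dist) (auto simp: less_imp_le)
  then have "\<exists>F. finite F \<and> card F = card ((\<lambda>x. ball x (\<delta>/2)) ` k) \<and> E \<subseteq> \<Union>F \<and>
             (\<forall>U\<in>F. bounded U \<and> diameter U \<le> \<delta>)"
    using k by (intro exI[of _ "(\<lambda>x. ball x (\<delta>/2)) ` k"]) auto
  then show ?thesis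
    unfolding covering_number_def by (rule LeastI)
qed

lemma covering_number_pos:
  fixes E :: "'a::metric_space set"
  assumes "compact E" "E \<noteq> {}" "0 < \<delta>"
  shows "1 \<le> covering_number \<delta> E"
proof -
  obtain F where F: "finite F" "card F = covering_number \<delta> E" "E \<subseteq> \<Union>F"
    using covering_number_attained[OF assms(1,3)] by blast
  then have "F \<noteq> {}" using assms(2) by auto
  then show ?thesis using F by (metis Suc_leI One_nat_def card_gt_0_iff)
qed

lemma hausdorff_premeasure_antimono:
  assumes "\<delta> \<le> \<delta>'"
  shows "hausdorff_premeasure s \<delta>' E \<le> hausdorff_premeasure s \<delta> E"
  unfolding hausdorff_premeasure_def
  by (rule INF_superset_mono) (use assms in \<open>auto intro: order_trans\<close>)

lemma hausdorff_premeasure_le_covering_number: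
  fixes E :: "'a::metric_space set"
  assumes "compact E" "0 < \<delta>" "0 < s"
  shows "hausdorff_premeasure s \<delta> E \<le> ennreal (real (covering_number \<delta> E) * \<delta> powr s)"
proof -
  obtain F where F: "finite F" "card F = covering_number \<delta> E" "E \<subseteq> \<Union>F"
      "\<forall>U\<in>F. bounded U \<and> diameter U \<le> \<delta>"
    using covering_number_attained[OF assms(1,2)] by blast
  obtain g where g: "bij_betw g {..<card F} F"
    using ex_bij_betw_nat_finite[OF F(1)] by (auto simp: atLeast0LessThan)
  \<comment> \<open>Padding by empty sets costs nothing: their diameter is 0 and
    \<open>0 powr s = 0\<close>.\<close>
  define U where "U n = (if n < card F then g n else {})" for n
  have gF: "g n \<in> F" if "n < card F" for n using g that by (auto simp: bij_betw_def)
  have "E \<subseteq> (\<Union>n. U n)"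
  proof
    fix x assume "x \<in> E"
    then obtain V where V: "V \<in> F" "x \<in> V" using F(3) by blast
    then obtain n where "n < card F" "g n = V"
      using g unfolding bij_betw_def by (metis imageE lessThan_iff)
    with V have "n < card F" "x \<in> g n" by auto
    then show "x \<in> (\<Union>n. U n)" by (auto simp: U_def intro!: exI[of _ n])
  qed
  moreover have Ud: "bounded (U n) \<and> diameter (U n) \<le> \<delta>" for n
    using F(4) gF assms(2) by (auto simp: U_def)
  ultimately have "hausdorff_premeasure s \<delta> E \<le> (\<Sum>n. ennreal (diameter (U n) powr s))"
    unfolding hausdorff_premeasure_def by (intro INF_lower) auto
  also have "\<dots> = (\<Sum>n<card F. ennreal (diameter (U n) powr s))"
    by (intro suminf_finite) (auto simp: U_def)
  also have "\<dots> \<le> (\<Sum>n<card F. ennreal (\<delta> powr s))"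
    using Ud assms by (intro sum_mono ennreal_leI powr_mono2) (auto intro: diameter_ge_0)
  also have "\<dots> = ennreal (real (covering_number \<delta> E) * \<delta> powr s)"
    by (simp add: F(2) ennreal_mult' ennreal_of_nat_eq_real_of_nat)
  finally show ?thesis .
qed

text \<open>An optimal cover at scale \<open>\<delta>\<close> has weight at most
  \<open>C * \<delta> powr (t' - t)\<close>, which tends to 0. Arbitrarily small scales suffice,
  hence the frequently quantifier; the lower bound for the box dimension relies on this weak
  form.\<close>

lemma hausdorff_measure_eq_0I:
  fixes E :: "'a::metric_space set"
  assumes "compact E" "0 < t" "t < t'"
    and fr: "\<exists>\<^sub>F \<delta> in at_right 0. real (covering_number \<delta> E) \<le> C * \<delta> powr (- t)"
  shows "hausdorff_measure t' E = 0"
proof -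
  have "hausdorff_premeasure t' \<delta>0 E \<le> 0" if "\<delta>0 > 0" for \<delta>0
  proof (rule ennreal_le_epsilon)
    fix e :: real assume e: "0 < e"
    have "((\<lambda>\<delta>::real. \<delta> powr (t' - t)) \<longlongrightarrow> 0) (at_right 0)"
      using assms(3) by real_asymp
    then have "((\<lambda>\<delta>. C * \<delta> powr (t' - t)) \<longlongrightarrow> C * 0) (at_right 0)"
      by (rule tendsto_mult_left)
    then have "\<forall>\<^sub>F \<delta> in at_right 0. C * \<delta> powr (t' - t) < e"
      using e assms by (intro order_tendstoD) auto
    moreover have "\<forall>\<^sub>F \<delta> in at_right 0. 0 < \<delta> \<and> \<delta> < \<delta>0"
      using that by (auto simp: eventually_at_right_field intro!: exI[of _ \<delta>0])
    ultimately obtain \<delta> where d: "real (covering_number \<delta> E) \<le> C * \<delta> powr (- t)"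
        "C * \<delta> powr (t' - t) < e" "0 < \<delta>" "\<delta> < \<delta>0"
      using frequently_ex[OF frequently_eventually_frequently[OF
          frequently_eventually_frequently[OF fr]]] by blast
    have "hausdorff_premeasure t' \<delta>0 E \<le> hausdorff_premeasure t' \<delta> E"
      using d by (intro hausdorff_premeasure_antimono) auto
    also have "\<dots> \<le> ennreal (real (covering_number \<delta> E) * \<delta> powr t')"
      using assms d by (intro hausdorff_premeasure_le_covering_number) auto
    also have "\<dots> \<le> ennreal (C * \<delta> powr (- t) * \<delta> powr t')"
      using d by (intro ennreal_leI mult_right_mono) auto
    also have "C * \<delta> powr (- t) * \<delta> powr t' = C * \<delta> powr (t' - t)"
      using d by (simp add: powr_add[symmetric] mult.assoc)
    also have "ennreal \<dots> \<le> ennreal e" using d by (intro ennreal_leI) auto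
    finally show "hausdorff_premeasure t' \<delta>0 E \<le> 0 + ennreal e" by simp
  qed
  then have "hausdorff_measure t' E \<le> 0"
    unfolding hausdorff_measure_def by (intro SUP_least) auto
  then show ?thesis by simp
qed

text \<open>The constant \<open>C\<close> disappears in the limit: \<open>ln C\<close> is negligible
  against \<open>(a - s) * (- ln \<delta>)\<close>.\<close>

lemma box_ratio_upper:
  fixes E :: "'a::metric_space set"
  assumes "compact E" "E \<noteq> {}" "0 < C" "s < a"
    and ev: "\<forall>\<^sub>F \<delta> in at_right 0. real (covering_number \<delta> E) \<le> C * \<delta> powr (- s)"
  shows "\<forall>\<^sub>F \<delta> in at_right 0. ln (real (covering_number \<delta> E)) / - ln \<delta> < a"
proof -
  have "\<forall>\<^sub>F \<delta> in at_right (0::real). ln C < (a - s) * (- ln \<delta>)"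
    using assms(4) by real_asymp
  moreover have "\<forall>\<^sub>F \<delta> in at_right (0::real). 0 < \<delta> \<and> \<delta> < 1"
    by (auto simp: eventually_at_right_field intro!: exI[of _ 1])
  ultimately show ?thesis using ev
  proof eventually_elim
    case (elim \<delta>)
    have "ln (real (covering_number \<delta> E)) \<le> ln (C * \<delta> powr (- s))"
      using elim covering_number_pos[of E \<delta>] assms by (intro ln_mono) auto
    also have "\<dots> = ln C + s * (- ln \<delta>)"
      using elim assms by (simp add: ln_mult ln_powr)
    also have "\<dots> < a * (- ln \<delta>)" using elim by (simp add: algebra_simps)
    finally show ?case using elim by (simp add: field_simps)
  qed
qed

lemma covering_number_le_of_ratio:
  assumes "0 < \<delta>" "\<delta> < 1" "ln (real (covering_number \<delta> E)) / - ln \<delta> \<le> t"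
    and "1 \<le> covering_number \<delta> E"
  shows "real (covering_number \<delta> E) \<le> \<delta> powr (- t)"
proof -
  have "ln (real (covering_number \<delta> E)) \<le> t * (- ln \<delta>)"
    using assms by (simp add: field_simps)
  then have "exp (ln (real (covering_number \<delta> E))) \<le> exp (t * (- ln \<delta>))" by simp
  then show ?thesis using assms by (simp add: powr_def)
qed

subsection \<open>Words and cylinders\<close>

lemma word_product_simps [simp]:
  "word_product A [] = mat 1"
  "word_product A (i # w) = A i ** word_product A w"
  by (simp_all add: word_product_def)

lemma word_product_append: "word_product A (u @ v) = word_product A u ** word_product A v"
  by (induction u) (simp_all add: matrix_mul_assoc)

definition word_map :: "(nat \<Rightarrow> 'a \<Rightarrow> 'a) \<Rightarrow> nat list \<Rightarrow> 'a \<Rightarrow> 'a" where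
  "word_map T w = foldr (\<lambda>i g. T i \<circ> g) w id"

lemma word_map_simps [simp]:
  "word_map T [] x = x"
  "word_map T (i # w) x = T i (word_map T w x)"
  by (simp_all add: word_map_def)

lemma word_map_append: "word_map T (u @ v) x = word_map T u (word_map T v x)"
  by (induction u) simp_all

section \<open>The iterated function system and its cylinders\<close>

locale positive_ifs =
  fixes m :: nat and A :: "nat \<Rightarrow> real^2^2" and d :: "nat \<Rightarrow> real^2"
    and T :: "nat \<Rightarrow> real^2 \<Rightarrow> real^2" and E :: "(real^2) set"
  assumes m_ge_1: "1 \<le> m"
    and T_eq: "\<And>i x. i \<in> {1..m} \<Longrightarrow> T i x = A i *v x + d i"
    and inv: "\<And>i. i \<in> {1..m} \<Longrightarrow> invertible (A i)"
    and pos: "\<And>i j k. i \<in> {1..m} \<Longrightarrow> 0 < A i $ j $ k"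
    and contr: "\<And>i. i \<in> {1..m} \<Longrightarrow> onorm (\<lambda>x. A i *v x) < 1"
    and attr: "is_attractor m T E"
    and disj: "disjoint_family_on (\<lambda>i. T i ` E) {1..m}"
begin

abbreviation P where "P w \<equiv> word_product A w"
abbreviation N where "N w \<equiv> entry_sum (word_product A w)"
abbreviation cyl where "cyl w \<equiv> word_map T w ` E"
abbreviation W where "W \<equiv> {w. set w \<subseteq> {1..m}}"

text \<open>The vectors behind the difference directions. Working with vectors instead of directions
  gives a compact set on which functionals attain their minimum.\<close>

definition K :: "(real^2) set" where
  "K = {x - y | x y i j. i \<in> {1..m} \<and> j \<in> {1..m} \<and> i \<noteq> j \<and> x \<in> T i ` E \<and> y \<in> T j ` E}"

lemma E_ne: "E \<noteq> {}" and E_compact: "compact E" and E_eq: "E = (\<Union>i\<in>{1..m}. T i ` E)"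
  using attr by (auto simp: is_attractor_def)

lemma T_sub: "i \<in> {1..m} \<Longrightarrow> T i ` E \<subseteq> E"
  using E_eq by blast

lemma T_diff: "i \<in> {1..m} \<Longrightarrow> T i x - T i y = A i *v (x - y)"
  by (simp add: T_eq matrix_vector_mult_diff_distrib)

lemma T_inj: "i \<in> {1..m} \<Longrightarrow> inj (T i)"
  using inj_matrix_vector_mult[OF inv, of i] by (auto simp: inj_on_def T_eq)

lemma word_map_diff: "w \<in> W \<Longrightarrow> word_map T w x - word_map T w y = P w *v (x - y)"
proof (induction w)
  case (Cons i w)
  then show ?case
    using T_diff[of i] by (simp add: matrix_vector_mul_assoc[symmetric])
qed simp

lemma cyl_sub: "w \<in> W \<Longrightarrow> cyl w \<subseteq> E"
proof (induction w)
  case (Cons i w)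
  then show ?case using T_sub[of i] by auto
qed simp

lemma cyl_append: "cyl (u @ v) = word_map T u ` cyl v"
  by (auto simp: word_map_append image_image)

lemma cyl_append_sub: "v \<in> W \<Longrightarrow> cyl (u @ v) \<subseteq> cyl u"
  unfolding cyl_append using cyl_sub by blast

lemma cyl_split: "x \<in> cyl w \<Longrightarrow> \<exists>i\<in>{1..m}. x \<in> cyl (w @ [i])"
proof -
  assume "x \<in> cyl w"
  then obtain x' where x': "x' \<in> E" "x = word_map T w x'" by blast
  then obtain i x'' where "i \<in> {1..m}" "x'' \<in> E" "x' = T i x''" using E_eq by blast
  then show ?thesis using x' by (auto simp: word_map_append)
qed

lemma E_cyl: "x \<in> E \<Longrightarrow> \<exists>w\<in>W. length w = n \<and> x \<in> cyl w"
proof (induction n)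
  case 0
  then show ?case by (intro bexI[of _ "[]"]) auto
next
  case (Suc n)
  then obtain w where w: "w \<in> W" "length w = n" "x \<in> cyl w" by blast
  then obtain i where "i \<in> {1..m}" "x \<in> cyl (w @ [i])" using cyl_split by blast
  then show ?case using w by (intro bexI[of _ "w @ [i]"]) auto
qed

text \<open>A common point forces equal first letters by strong separation; injectivity of
  \<open>T i\<close> then strips that letter, and induction continues.\<close>

lemma cyl_meet_prefix:
  assumes "u \<in> W" "v \<in> W" "cyl u \<inter> cyl v \<noteq> {}" "length u \<le> length v"
  shows "take (length u) v = u"
  using assms
proof (induction u arbitrary: v)
  case (Cons i u)
  then obtain j v' where v: "v = j # v'" by (cases v) auto
  obtain x y where xy: "x \<in> E" "y \<in> E" "T i (word_map T u x) = T j (word_map T v' y)"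
    using Cons.prems v by auto
  have ij: "i \<in> {1..m}" "j \<in> {1..m}" using Cons.prems v by auto
  have in_E: "word_map T u x \<in> E" "word_map T v' y \<in> E"
    using cyl_sub[of u] cyl_sub[of v'] Cons.prems v xy by auto
  have "i = j"
  proof (rule ccontr)
    assume "i \<noteq> j"
    then have "T i ` E \<inter> T j ` E = {}"
      using disj ij by (auto simp: disjoint_family_on_def)
    then show False using in_E xy(3) by (metis disjoint_iff imageI)
  qed
  then have "word_map T u x = word_map T v' y"
    using xy(3) T_inj[OF ij(1)] by (auto dest: injD)
  then have "cyl u \<inter> cyl v' \<noteq> {}" using xy by auto
  then show ?case using Cons v \<open>i = j\<close> by auto
qed simp

lemma finite_W: "finite {w \<in> W. length w \<le> n}"
  using finite_lists_length_le[of "{1..m}" n] by (auto elim: rev_finite_subset)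

section \<open>Entry sums of word products\<close>

lemma nonneg_P: "w \<in> W \<Longrightarrow> nonneg_mat (P w)"
proof (induction w)
  case Nil
  then show ?case by (simp add: nonneg_mat_def mat_def)
next
  case (Cons i w)
  then show ?case
    using pos[of i] by (auto intro!: nonneg_mat_mult simp: less_imp_le) (auto simp: nonneg_mat_def less_imp_le)
qed

lemma pos_P: "w \<in> W \<Longrightarrow> w \<noteq> [] \<Longrightarrow> 0 < P w $ j $ k"
proof (induction w arbitrary: j k)
  case (Cons i w)
  show ?case
  proof (cases "w = []")
    case True then show ?thesis using Cons pos by simp
  next
    case False then show ?thesis
      using Cons pos[of i] by (auto simp: mult_mat_2 intro!: add_pos_pos mult_pos_pos)
  qed
qed simp

lemma N_pos: "w \<in> W \<Longrightarrow> 0 < N w"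
proof (cases "w = []")
  case True then show ?thesis by (simp add: entry_sum_def mat_def)
next
  case False then show "w \<in> W \<Longrightarrow> 0 < N w"
    using pos_P unfolding entry_sum_def by (simp add: add_pos_pos)
qed

lemma N_append: "u \<in> W \<Longrightarrow> v \<in> W \<Longrightarrow> N (u @ v) \<le> N u * N v"
  by (simp add: word_product_append entry_sum_mult_le nonneg_P)

lemma norm_P_le: "w \<in> W \<Longrightarrow> norm (P w *v x) \<le> N w * norm x"
  by (intro norm_mult_le_entry_sum nonneg_P)

text \<open>A single \<open>A i\<close> may have entry sum above 1, so submultiplicativity alone
  gives no decay. The operator norm does contract, and evaluation at \<open>ones\<close> transfers
  this to \<open>N\<close> at the cost of the factor 4.\<close>

lemma N_decay: "\<exists>\<rho>. 0 < \<rho> \<and> \<rho> < 1 \<and> (\<forall>w\<in>W. N w \<le> 4 * \<rho> ^ length w)"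
proof -
  \<comment> \<open>The inserted 1/2 guarantees \<open>0 < \<rho>\<close>.\<close>
  define \<rho> where "\<rho> = Max (insert (1/2) ((\<lambda>i. onorm (\<lambda>x. A i *v x)) ` {1..m}))"
  have r: "1/2 \<le> \<rho>" "\<rho> < 1" and ri: "\<And>i. i \<in> {1..m} \<Longrightarrow> onorm (\<lambda>x. A i *v x) \<le> \<rho>"
  proof -
    have fin: "finite (insert (1/2) ((\<lambda>i. onorm (\<lambda>x. A i *v x)) ` {1..m}))" by simp
    show "1/2 \<le> \<rho>" unfolding \<rho>_def using fin by (rule Max_ge) simp
    show "\<rho> < 1" unfolding \<rho>_def using contr by (subst Max_less_iff[OF fin]) auto
    show "onorm (\<lambda>x. A i *v x) \<le> \<rho>" if "i \<in> {1..m}" for i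
      unfolding \<rho>_def using fin that by (intro Max_ge) auto
  qed
  have n: "norm (P w *v x) \<le> \<rho> ^ length w * norm x" if "w \<in> W" for w x
    using that
  proof (induction w)
    case (Cons i w)
    have "norm (A i *v (P w *v x)) \<le> onorm (\<lambda>x. A i *v x) * norm (P w *v x)"
      by (intro onorm matrix_vector_mul_bounded_linear)
    also have "\<dots> \<le> \<rho> * (\<rho> ^ length w * norm x)"
      using Cons ri[of i] r by (intro mult_mono) auto
    finally show ?case by (simp add: matrix_vector_mul_assoc)
  qed simp
  have o: "norm ones \<le> 2"
    using norm_le_l1_cart[of ones] by (simp add: sum_2 ones_def)
  have "N w \<le> 4 * \<rho> ^ length w" if "w \<in> W" for w
  proof -
    have "N w \<le> 2 * (\<rho> ^ length w * norm ones)"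
      using entry_sum_le_norm_ones[of "P w"] n[OF that, of ones] by linarith
    also have "\<dots> \<le> 2 * (\<rho> ^ length w * 2)"
      using o r by (intro mult_left_mono) auto
    finally show ?thesis by simp
  qed
  then show ?thesis using r by (intro exI[of _ \<rho>]) auto
qed

lemma N_small: "0 < e \<Longrightarrow> \<exists>n. \<forall>w\<in>W. n \<le> length w \<longrightarrow> N w < e"
proof -
  assume e: "0 < e"
  obtain \<rho> where r: "0 < \<rho>" "\<rho> < 1" "\<forall>w\<in>W. N w \<le> 4 * \<rho> ^ length w"
    using N_decay by blast
  obtain n where n: "\<rho> ^ n < e / 4" using real_arch_pow_inv[of "e/4" \<rho>] e r by auto
  have "N w < e" if "w \<in> W" "n \<le> length w" for w
  proof -
    have "\<rho> ^ length w \<le> \<rho> ^ n" using r that by (intro power_decreasing) auto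
    then show ?thesis using r(3) n that by fastforce
  qed
  then show ?thesis by blast
qed

text \<open>The added 1 keeps \<open>D\<close> positive when \<open>E\<close> is a single point, so
  that division by \<open>D\<close> is safe.\<close>

definition D :: real where "D = diameter E + 1"

lemma D_pos: "0 < D"
  using diameter_ge_0[OF compact_imp_bounded[OF E_compact]] by (simp add: D_def)

lemma norm_diff_le_D: "x \<in> E \<Longrightarrow> y \<in> E \<Longrightarrow> norm (x - y) \<le> D"
  using diameter_bounded_bound[OF compact_imp_bounded[OF E_compact]]
  by (fastforce simp: D_def dist_norm)

lemma cyl_dist: "w \<in> W \<Longrightarrow> x \<in> cyl w \<Longrightarrow> y \<in> cyl w \<Longrightarrow> norm (x - y) \<le> N w * D"
proof -
  assume w: "w \<in> W" and "x \<in> cyl w" "y \<in> cyl w"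
  then obtain x' y' where xy: "x' \<in> E" "y' \<in> E" "x = word_map T w x'" "y = word_map T w y'"
    by blast
  have "norm (x - y) \<le> N w * norm (x' - y')"
    using w xy norm_P_le by (simp add: word_map_diff)
  also have "\<dots> \<le> N w * D"
    using w xy N_pos norm_diff_le_D by (intro mult_left_mono) (auto simp: less_imp_le)
  finally show ?thesis .
qed

section \<open>Differences of points in distinct pieces\<close>

lemma K_compact: "compact K"
proof -
  let ?I = "{(i, j). i \<in> {1..m} \<and> j \<in> {1..m} \<and> i \<noteq> j}"
  have "K = (\<Union>(i, j)\<in>?I. {x - y | x y. x \<in> T i ` E \<and> y \<in> T j ` E})"
    unfolding K_def by blast
  moreover have "finite ?I"
    by (rule finite_subset[of _ "{1..m} \<times> {1..m}"]) auto
  moreover have "compact (T i ` E)" if "i \<in> {1..m}" for i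
  proof (rule compact_continuous_image[OF _ E_compact])
    have "continuous_on E (\<lambda>x. A i *v x + d i)"
      by (intro continuous_intros)
    then show "continuous_on E (T i)"
      using T_eq[OF that] by (simp cong: continuous_on_cong)
  qed
  ultimately show ?thesis
    by (auto intro!: compact_UN compact_differences)
qed

lemma K_nonzero: "0 \<notin> K"
proof
  assume "0 \<in> K"
  then obtain x i j where "i \<in> {1..m}" "j \<in> {1..m}" "i \<noteq> j" "x \<in> T i ` E \<inter> T j ` E"
    unfolding K_def by auto
  then show False using disj unfolding disjoint_family_on_def by blast
qed

text \<open>Take a longest \<open>w\<close> whose cylinder contains \<open>U\<close>; it exists
  because cylinders shrink while \<open>U\<close> has two distinct points. Two points of
  \<open>U\<close> then lie in different children of \<open>cyl w\<close>, and undoing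
  \<open>w\<close> turns their difference into an element of \<open>K\<close>. Pairs and whole
  covering sets are both instances of \<open>U\<close>.\<close>

lemma first_separation:
  assumes "U \<subseteq> E" "x0 \<in> U" "y0 \<in> U" "x0 \<noteq> y0"
  shows "\<exists>w\<in>W. U \<subseteq> cyl w \<and> (\<exists>x\<in>U. \<exists>y\<in>U. \<exists>u\<in>K. x - y = P w *v u)"
proof -
  let ?Q = "\<lambda>n. \<exists>w\<in>W. length w = n \<and> U \<subseteq> cyl w"
  obtain b where b: "\<forall>w\<in>W. b \<le> length w \<longrightarrow> N w < norm (x0 - y0) / D"
    using N_small[of "norm (x0 - y0) / D"] assms D_pos by auto
  have bound: "\<not> ?Q n" if "n \<ge> b" for n
  proof
    assume "?Q n"
    then obtain w where w: "w \<in> W" "length w = n" "U \<subseteq> cyl w" by blast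
    then have "norm (x0 - y0) \<le> N w * D" using assms cyl_dist by blast
    moreover have "N w < norm (x0 - y0) / D" using b w that by blast
    ultimately show False using D_pos by (simp add: field_simps)
  qed
  have "?Q 0" using assms by (intro bexI[of _ "[]"]) auto
  \<comment> \<open>\<open>?Q\<close> holds at 0 and fails from \<open>b\<close> on, so it switches
    from true to false somewhere.\<close>
  have "\<exists>n. ?Q n \<and> \<not> ?Q (Suc n)"
  proof (rule ccontr)
    assume step: "\<nexists>n. ?Q n \<and> \<not> ?Q (Suc n)"
    have "?Q n" for n
    proof (induction n)
      case (Suc n)
      then show ?case using step by blast
    qed (fact \<open>?Q 0\<close>)
    then show False using bound by blast
  qed
  then obtain n where n: "?Q n" "\<not> ?Q (Suc n)" by blast
  from n(1) obtain w where w: "w \<in> W" "length w = n" "U \<subseteq> cyl w"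
    by (elim bexE conjE) (rule that)
  obtain i where i: "i \<in> {1..m}" "x0 \<in> cyl (w @ [i])"
    using cyl_split[OF subsetD[OF w(3) assms(2)]] by (elim bexE) (rule that)
  have "\<not> U \<subseteq> cyl (w @ [i])"
  proof
    assume "U \<subseteq> cyl (w @ [i])"
    moreover have "w @ [i] \<in> W" "length (w @ [i]) = Suc n" using w i by auto
    ultimately show False using n(2) by blast
  qed
  then obtain y where y: "y \<in> U" "y \<notin> cyl (w @ [i])" by blast
  obtain j where j: "j \<in> {1..m}" "y \<in> cyl (w @ [j])"
    using cyl_split[OF subsetD[OF w(3) y(1)]] by (elim bexE) (rule that)
  have "i \<noteq> j" using y j by auto
  obtain a a' where a: "a \<in> E" "x0 = word_map T w (T i a)" "a' \<in> E" "y = word_map T w (T j a')"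
    using i j by (auto simp: word_map_append)
  have "x0 - y = P w *v (T i a - T j a')" using a w by (simp add: word_map_diff)
  moreover have "T i a - T j a' \<in> K" unfolding K_def using a i j \<open>i \<noteq> j\<close> by blast
  ultimately show ?thesis using w y assms by blast
qed

section \<open>Uniform bounds from strict positivity\<close>

lemma entry_bounds: "\<exists>p>0. \<exists>q>0. \<forall>i\<in>{1..m}. \<forall>j k. p \<le> A i $ j $ k \<and> A i $ j $ k \<le> q"
proof -
  define S where "S = (\<lambda>(i, j, k). A i $ j $ k) ` ({1..m} \<times> UNIV \<times> UNIV)"
  have fin: "finite S" and ne: "S \<noteq> {}" using m_ge_1 by (auto simp: S_def)
  have S: "A i $ j $ k \<in> S" if "i \<in> {1..m}" for i j k
    unfolding S_def using that by (intro image_eqI[of _ _ "(i, j, k)"]) auto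
  have "0 < x" if "x \<in> S" for x using that pos by (auto simp: S_def)
  then have "0 < Min S" "0 < Max S" using Min_in[OF fin ne] Max_in[OF fin ne] by blast+
  then show ?thesis using Min_le[OF fin S] Max_ge[OF fin S] by blast
qed

text \<open>One application of a strictly positive matrix makes the two coordinates of any nonnegative
  vector comparable, uniformly over the finitely many \<open>A i\<close>.\<close>

lemma coords_comparable:
  "\<exists>\<kappa>>0. \<forall>w\<in>W. \<forall>j. \<kappa> * N w \<le> (P w *v ones) $ j"
proof -
  obtain p q where p: "0 < p" and q: "0 < q"
    and pq': "\<forall>i\<in>{1..m}. \<forall>j k. p \<le> A i $ j $ k \<and> A i $ j $ k \<le> q"
    using entry_bounds by blast
  then have pq: "p \<le> A i $ j $ k" "A i $ j $ k \<le> q" if "i \<in> {1..m}" for i j k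
    using that by blast+
  have "p \<le> q" using pq[of 1 1 1] m_ge_1 by auto
  \<comment> \<open>Each coordinate is at least \<open>p * (z$1 + z$2)\<close>, while the entry sum
    is at most \<open>2 * q * (z$1 + z$2)\<close>. The empty word, with entry sum 2 and coordinates
    1, needs \<open>\<kappa> \<le> 1/2\<close>.\<close>
  define \<kappa> where "\<kappa> = p / (2 * q)"
  have k: "0 < \<kappa>" "\<kappa> \<le> 1/2" using p q \<open>p \<le> q\<close> by (auto simp: \<kappa>_def field_simps)
  have "\<kappa> * N w \<le> (P w *v ones) $ j" if "w \<in> W" for w j
  proof (cases w)
    case Nil
    then show ?thesis using k by (simp add: ones_def) (simp add: entry_sum_def mat_def)
  next
    case (Cons i v)
    define z where "z = P v *v ones"
    have z: "0 \<le> z $ k" for k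
      using nonneg_P[of v] that Cons by (auto simp: z_def mult_vec_2 ones_def nonneg_mat_def)
    have i: "i \<in> {1..m}" using that Cons by auto
    have e: "P w *v ones = A i *v z" unfolding z_def by (simp add: Cons matrix_vector_mul_assoc)
    have lo: "p * (z$1 + z$2) \<le> (A i *v z) $ j" for j
      unfolding mult_vec_2 distrib_left using z pq[OF i] by (intro add_mono mult_right_mono) auto
    have hi: "(A i *v z) $ j \<le> q * (z$1 + z$2)" for j
      unfolding mult_vec_2 distrib_left using z pq[OF i] by (intro add_mono mult_right_mono) auto
    have "N w = (P w *v ones) $ 1 + (P w *v ones) $ 2"
      by (simp add: entry_sum_def mult_vec_2 ones_def)
    then have "N w \<le> 2 * q * (z$1 + z$2)" using hi[of 1] hi[of 2] e by simp
    then have "\<kappa> * N w \<le> \<kappa> * (2 * q * (z$1 + z$2))" using k by (intro mult_left_mono) auto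
    also have "\<dots> = p * (z$1 + z$2)" using q by (simp add: \<kappa>_def)
    finally show ?thesis using lo[of j] e by simp
  qed
  then show ?thesis using k by blast
qed

text \<open>Ensures that a word stopped when its entry sum first drops below a threshold is still
  comparable to that threshold.\<close>

lemma N_snoc_ge: "\<exists>c>0. \<forall>w\<in>W. \<forall>i\<in>{1..m}. c * N w \<le> N (w @ [i])"
proof -
  obtain p where p: "0 < p" and pq': "\<forall>i\<in>{1..m}. \<forall>j k. p \<le> A i $ j $ k"
    using entry_bounds by blast
  then have pq: "p \<le> A i $ j $ k" if "i \<in> {1..m}" for i j k
    using that by blast
  have "p * N w \<le> N (w @ [i])" if "w \<in> W" "i \<in> {1..m}" for w i
  proof -
    have nn: "0 \<le> P w $ j $ k" for j k using nonneg_P[OF that(1)] by (simp add: nonneg_mat_def)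
    have g: "P w $ j $ k * p \<le> P w $ j $ k * A i $ k $ l" for j k l
      using nn pq[OF that(2)] by (intro mult_left_mono) auto
    have g0: "0 \<le> P w $ j $ k * A i $ k $ l" for j k l
      using nn pos[OF that(2)] by (simp add: less_imp_le)
    \<comment> \<open>The first column of \<open>A i\<close> alone reproduces every entry of
      \<open>P w\<close> with factor at least \<open>p\<close>; the second column only adds
      nonnegative terms.\<close>
    show ?thesis
      using g[of 1 1 1] g[of 1 2 1] g[of 2 1 1] g[of 2 2 1] g0[of 1 1 2] g0[of 1 2 2] g0[of 2 1 2] g0[of 2 2 2]
      unfolding entry_sum_def by (simp add: word_product_append mult_mat_2 algebra_simps)
  qed
  then show ?thesis using p by blast
qed

end

subsection \<open>A functional expanding along the cylinders\<close>

text \<open>Intermediate value theorem with the sign change encoded as a product, so that the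
  orientation need not be known.\<close>

lemma ivt_zero:
  fixes g :: "real \<Rightarrow> real"
  assumes "continuous_on {a..b} g" "a \<le> b" "g a * g b \<le> 0"
  shows "\<exists>t\<in>{a..b}. g t = 0"
proof (cases "g a \<le> 0")
  case True
  show ?thesis
  proof (cases "0 \<le> g b")
    case True
    with \<open>g a \<le> 0\<close> show ?thesis using IVT'[of g a 0 b] assms by force
  next
    case False
    then have "g a = 0" using \<open>g a \<le> 0\<close> assms(3) by (auto simp: mult_le_0_iff)
    then show ?thesis using assms(2) by force
  qed
next
  case False
  then have "g b \<le> 0" using assms(3) by (auto simp: mult_le_0_iff)
  then show ?thesis using IVT2'[of g b 0 a] assms False by force
qed

section \<open>Directions and their normals\<close>

lemma direction_scaleR: "k \<noteq> 0 \<Longrightarrow> direction (k *\<^sub>R w) = direction w"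
  by (cases "0 < k") (auto simp: direction_def sgn_scaleR)

lemma direction_eqD:
  assumes "direction x = direction y" "x \<noteq> 0" "y \<noteq> 0"
  shows "\<exists>k. k \<noteq> 0 \<and> x = k *\<^sub>R y"
proof -
  have "sgn x = sgn y \<or> sgn x = - sgn y"
    using assms(1) by (auto simp: direction_def)
  then obtain e :: real where e: "e \<noteq> 0" "sgn x = e *\<^sub>R sgn y"
    by (metis scaleR_minus1_left scaleR_one neg_equal_0_iff_equal zero_neq_one)
  have "x = norm x *\<^sub>R sgn x" using assms by (simp add: sgn_div_norm)
  also have "\<dots> = (norm x * e / norm y) *\<^sub>R y"
    unfolding e(2) by (simp add: sgn_div_norm divide_inverse mult.assoc)
  finally show ?thesis using assms e(1) by (metis scaleR_zero_left)
qed

definition dir_vec :: "real \<Rightarrow> real^2" where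
  "dir_vec t = vector [cos t, sin t]"

text \<open>\<open>dir_vec t\<close> turned by a quarter; as a functional it vanishes exactly on the
  line spanned by \<open>dir_vec t\<close>.\<close>

definition normal_vec :: "real \<Rightarrow> real^2" where
  "normal_vec t = vector [- sin t, cos t]"

lemma dir_vec_nth [simp]: "dir_vec t $ 1 = cos t" "dir_vec t $ 2 = sin t"
  and normal_vec_nth [simp]: "normal_vec t $ 1 = - sin t" "normal_vec t $ 2 = cos t"
  by (simp_all add: dir_vec_def normal_vec_def)

lemma dir_vec_nonzero: "dir_vec t \<noteq> 0"
proof
  assume "dir_vec t = 0"
  then have "cos t = 0" "sin t = 0" by (metis dir_vec_nth zero_index)+
  then show False using sin_cos_squared_add[of t] by simp
qed

lemma frame_decomp:
  "x = (dir_vec t \<bullet> x) *\<^sub>R dir_vec t + (normal_vec t \<bullet> x) *\<^sub>R normal_vec t"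
proof -
  have "sin t * sin t + cos t * cos t = 1" using sin_cos_squared_add[of t] by (simp add: power2_eq_square)
  then show ?thesis
    unfolding vec_eq_iff forall_2 inner_vec2 by simp algebra
qed

text \<open>The coefficients are \<open>sin (b - t) / sin (b - a)\<close> and
  \<open>sin (t - a) / sin (b - a)\<close>, nonnegative because the arc is shorter than
  \<open>pi\<close>. The degenerate arc is separate, as there the denominator vanishes.\<close>

lemma normal_vec_between:
  assumes "a \<le> t" "t \<le> b" "b < a + pi"
  shows "\<exists>\<alpha>\<ge>0. \<exists>\<beta>\<ge>0. normal_vec t = \<alpha> *\<^sub>R normal_vec a + \<beta> *\<^sub>R normal_vec b"
proof (cases "a = b")
  case True
  then show ?thesis using assms by (intro exI[of _ 1] conjI exI[of _ 0]) auto
next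
  case False
  have s: "0 < sin (b - a)" using assms False by (intro sin_gt_zero) auto
  have p: "0 \<le> sin (b - t)" "0 \<le> sin (t - a)" using assms by (auto intro!: sin_ge_zero)
  have "sin (b - a) * sin t = sin (b - t) * sin a + sin (t - a) * sin b"
       "sin (b - a) * cos t = sin (b - t) * cos a + sin (t - a) * cos b"
    unfolding sin_diff by (simp_all add: algebra_simps)
  then have "normal_vec t = (sin (b - t) / sin (b - a)) *\<^sub>R normal_vec a
               + (sin (t - a) / sin (b - a)) *\<^sub>R normal_vec b"
    using s by (simp add: vec_eq_iff forall_2 field_simps)
  then show ?thesis using p s by (meson divide_nonneg_pos)
qed

context positive_ifs begin

text \<open>By cone invariance, \<open>l0 + l1\<close> composed with \<open>P w\<close> is
  \<open>\<alpha> l0 + \<beta> l1\<close> with nonnegative coefficients. Evaluation at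
  \<open>ones\<close> shows that \<open>\<alpha> + \<beta>\<close> is at least a multiple of
  \<open>N w\<close>; on \<open>K\<close> the two terms have equal sign and cannot cancel.\<close>

lemma cone_expansion:
  fixes l0 l1 :: "real^2"
  assumes nn: "\<And>j. 0 \<le> l0 $ j" "\<And>j. 0 \<le> l1 $ j"
    and ne: "0 < l0 $ 1 + l0 $ 2" "0 < l1 $ 1 + l1 $ 2"
    and inv0: "\<And>i. i \<in> {1..m} \<Longrightarrow> \<exists>\<alpha>\<ge>0. \<exists>\<beta>\<ge>0. \<forall>x. l0 \<bullet> (A i *v x) = \<alpha> * (l0 \<bullet> x) + \<beta> * (l1 \<bullet> x)"
    and inv1: "\<And>i. i \<in> {1..m} \<Longrightarrow> \<exists>\<alpha>\<ge>0. \<exists>\<beta>\<ge>0. \<forall>x. l1 \<bullet> (A i *v x) = \<alpha> * (l0 \<bullet> x) + \<beta> * (l1 \<bullet> x)"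
    and K: "\<And>u. u \<in> K \<Longrightarrow> 0 < (l0 \<bullet> u) * (l1 \<bullet> u)"
  shows "\<exists>c>0. \<forall>w\<in>W. \<forall>u\<in>K. c * N w \<le> \<bar>(l0 + l1) \<bullet> (P w *v u)\<bar>"
proof -
  \<comment> \<open>Arbitrary weights \<open>a\<close>, \<open>b\<close> are needed for the
    induction: peeling off the first letter replaces them by other nonnegative weights.\<close>
  have cone: "\<exists>\<alpha>\<ge>0. \<exists>\<beta>\<ge>0. \<forall>x. a * (l0 \<bullet> (P w *v x)) + b * (l1 \<bullet> (P w *v x)) = \<alpha> * (l0 \<bullet> x) + \<beta> * (l1 \<bullet> x)"
    if "w \<in> W" "0 \<le> a" "0 \<le> b" for w a b
    using that
  proof (induction w arbitrary: a b)
    case Nil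
    then show ?case by auto
  next
    case (Cons i w)
    then have i: "i \<in> {1..m}" by auto
    obtain p q where 0: "0 \<le> p" "0 \<le> q" "\<forall>x. l0 \<bullet> (A i *v x) = p * (l0 \<bullet> x) + q * (l1 \<bullet> x)"
      using inv0[OF i] by blast
    obtain p' q' where 1: "0 \<le> p'" "0 \<le> q'" "\<forall>x. l1 \<bullet> (A i *v x) = p' * (l0 \<bullet> x) + q' * (l1 \<bullet> x)"
      using inv1[OF i] by blast
    have e: "a * (l0 \<bullet> (P (i # w) *v x)) + b * (l1 \<bullet> (P (i # w) *v x)) =
        (a * p + b * p') * (l0 \<bullet> (P w *v x)) + (a * q + b * q') * (l1 \<bullet> (P w *v x))" for x
      using 0(3) 1(3) by (simp add: matrix_vector_mul_assoc[symmetric] algebra_simps)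
    show ?case unfolding e using Cons 0 1 by (intro Cons.IH) auto
  qed
  obtain \<kappa> where k: "0 < \<kappa>" "\<forall>w\<in>W. \<forall>j. \<kappa> * N w \<le> (P w *v ones) $ j"
    using coords_comparable by blast
  have "\<exists>\<eta>>0. \<forall>u\<in>K. \<eta> \<le> min \<bar>l0 \<bullet> u\<bar> \<bar>l1 \<bullet> u\<bar>"
  \<comment> \<open>For a single map \<open>K\<close> is empty and there is no minimum to
    take.\<close>
  proof (cases "K = {}")
    case True then show ?thesis by (intro exI[of _ 1]) auto
  next
    case False
    have "continuous_on K (\<lambda>u. min \<bar>l0 \<bullet> u\<bar> \<bar>l1 \<bullet> u\<bar>)"
      by (intro continuous_intros)
    then obtain u0 where u0: "u0 \<in> K" "\<forall>u\<in>K. min \<bar>l0 \<bullet> u0\<bar> \<bar>l1 \<bullet> u0\<bar> \<le> min \<bar>l0 \<bullet> u\<bar> \<bar>l1 \<bullet> u\<bar>"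
      using continuous_attains_inf[OF K_compact False] by blast
    have "0 < min \<bar>l0 \<bullet> u0\<bar> \<bar>l1 \<bullet> u0\<bar>" using K[OF u0(1)] by auto
    then show ?thesis using u0 by blast
  qed
  then obtain \<eta> where eta: "0 < \<eta>" "\<forall>u\<in>K. \<eta> \<le> min \<bar>l0 \<bullet> u\<bar> \<bar>l1 \<bullet> u\<bar>" by blast
  define M where "M = l0 $ 1 + l0 $ 2 + l1 $ 1 + l1 $ 2"
  have M: "0 < M" using ne by (simp add: M_def)
  have main: "\<eta> * \<kappa> * N w \<le> \<bar>(l0 + l1) \<bullet> (P w *v u)\<bar>" if w: "w \<in> W" and u: "u \<in> K" for w u
  proof -
    obtain \<alpha> \<beta> where ab: "0 \<le> \<alpha>" "0 \<le> \<beta>"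
      and e: "\<forall>x. (l0 + l1) \<bullet> (P w *v x) = \<alpha> * (l0 \<bullet> x) + \<beta> * (l1 \<bullet> x)"
      using cone[OF w, of 1 1] by (auto simp: inner_add_left)
    \<comment> \<open>The functional is evaluated at \<open>ones\<close> in two ways: from below by
      the comparable coordinates of \<open>P w *v ones\<close>, from above because \<open>l0\<close>
      and \<open>l1\<close> are at most \<open>M\<close> at \<open>ones\<close>.\<close>
    have "M * (\<kappa> * N w) = (l0 $ 1 + l1 $ 1) * (\<kappa> * N w) + (l0 $ 2 + l1 $ 2) * (\<kappa> * N w)"
      by (simp add: M_def algebra_simps)
    also have "\<dots> \<le> (l0 $ 1 + l1 $ 1) * (P w *v ones) $ 1 + (l0 $ 2 + l1 $ 2) * (P w *v ones) $ 2"
      using k(2) w nn by (intro add_mono mult_left_mono) auto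
    also have "\<dots> = (l0 + l1) \<bullet> (P w *v ones)" by (simp add: inner_vec2)
    also have "\<dots> = \<alpha> * (l0 $ 1 + l0 $ 2) + \<beta> * (l1 $ 1 + l1 $ 2)"
      using e by (simp add: inner_vec2 ones_def)
    also have "\<dots> \<le> \<alpha> * M + \<beta> * M"
      using ab ne by (intro add_mono mult_left_mono) (auto simp: M_def)
    finally have "M * (\<kappa> * N w) \<le> M * (\<alpha> + \<beta>)" by (simp add: algebra_simps)
    then have ab2: "\<kappa> * N w \<le> \<alpha> + \<beta>" using M by simp
    have "\<eta> * (\<kappa> * N w) \<le> \<alpha> * \<eta> + \<beta> * \<eta>"
      using mult_left_mono[OF ab2, of \<eta>] eta by (simp add: algebra_simps)
    also have "\<dots> \<le> \<alpha> * \<bar>l0 \<bullet> u\<bar> + \<beta> * \<bar>l1 \<bullet> u\<bar>"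
      using eta(2) u ab by (intro add_mono mult_left_mono) auto
    also have "\<dots> = \<bar>\<alpha> * (l0 \<bullet> u) + \<beta> * (l1 \<bullet> u)\<bar>"
    proof (cases "0 < l0 \<bullet> u")
      case True
      then have "0 < l1 \<bullet> u" using K[OF u] by (simp add: zero_less_mult_iff)
      then show ?thesis using True ab by simp
    next
      case False
      then have "l0 \<bullet> u < 0" "l1 \<bullet> u < 0" using K[OF u] by (auto simp: zero_less_mult_iff)
      moreover from this have "\<alpha> * (l0 \<bullet> u) + \<beta> * (l1 \<bullet> u) \<le> 0"
        using ab by (simp add: add_nonpos_nonpos mult_nonneg_nonpos)
      ultimately show ?thesis by simp
    qed
    finally show ?thesis using e by (simp add: mult.assoc)
  qed
  show ?thesis using main eta(1) k(1) by (intro exI[of _ "\<eta> * \<kappa>"]) auto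
qed

text \<open>The cone is spanned by the suitably oriented normals at the two ends of the arc
  \<open>J\<close>, and \<open>l\<close> is their sum.\<close>

lemma expanding_functional:
  assumes J: "invariant_interval m A J" and JS: "J \<inter> difference_directions m T E = {}"
  shows "\<exists>l c. l \<noteq> 0 \<and> 0 < c \<and> (\<forall>w\<in>W. \<forall>u\<in>K. c * N w \<le> \<bar>l \<bullet> (P w *v u)\<bar>)"
proof -
  obtain a b where ab: "a \<le> b" "b < a + pi" and J_eq: "J = (\<lambda>t. direction (dir_vec t)) ` {a..b}"
    using J unfolding invariant_interval_def closed_interval_RP1_def dir_vec_def by blast
  have quad: "cos t * sin t \<le> 0" if "t \<in> {a..b}" for t
  proof -
    have "direction (dir_vec t) \<in> Q2"
      using J that J_eq unfolding invariant_interval_def by blast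
    then obtain w where w: "w \<noteq> 0" "w $ 1 * w $ 2 \<le> 0" "direction (dir_vec t) = direction w"
      unfolding Q2_def by blast
    then obtain k where k: "dir_vec t = k *\<^sub>R w" using direction_eqD dir_vec_nonzero by blast
    have "cos t * sin t = (k * w $ 1) * (k * w $ 2)"
      using arg_cong[OF k, of "\<lambda>x. x $ 1"] arg_cong[OF k, of "\<lambda>x. x $ 2"] by simp
    also have "\<dots> = k\<^sup>2 * (w $ 1 * w $ 2)" by (simp add: power2_eq_square)
    finally show ?thesis using w by (simp add: mult_nonneg_nonpos)
  qed
  \<comment> \<open>\<open>f t\<close> is the coordinate sum of \<open>normal_vec t\<close>. It
    could vanish only in the diagonal direction, which lies outside \<open>Q2\<close>, so it has
    constant sign \<open>\<sigma>\<close> on the arc, and \<open>\<sigma>\<close> orients all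
    normals into the nonnegative quadrant at once.\<close>
  define f :: "real \<Rightarrow> real" where "f t = cos t - sin t" for t
  have f_nz: "f t \<noteq> 0" if "t \<in> {a..b}" for t
  proof
    assume "f t = 0"
    then have "cos t = sin t" by (simp add: f_def)
    then have "sin t * sin t \<le> 0" using quad[OF that] by simp
    then have "sin t = 0" by (metis mult_eq_0_iff order_antisym zero_le_square)
    then show False using \<open>cos t = sin t\<close> sin_cos_squared_add[of t] by simp
  qed
  define \<sigma> where "\<sigma> = sgn (f a)"
  have sg: "\<sigma> = 1 \<or> \<sigma> = -1" using f_nz[of a] ab by (auto simp: \<sigma>_def sgn_if)
  have sf: "0 < \<sigma> * f t" if t: "t \<in> {a..b}" for t
  proof (rule ccontr)
    assume "\<not> 0 < \<sigma> * f t"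
    then have "f a * f t \<le> 0"
      using f_nz[of a] ab by (auto simp: \<sigma>_def sgn_if mult_le_0_iff split: if_splits)
    moreover have "continuous_on {a..t} f" unfolding f_def by (intro continuous_intros)
    ultimately obtain t' where "t' \<in> {a..t}" "f t' = 0" using ivt_zero[of a t f] t by auto
    then show False using f_nz[of t'] t by auto
  qed
  define L where "L t = \<sigma> *\<^sub>R normal_vec t" for t
  have Lsum: "0 < L t $ 1 + L t $ 2" if "t \<in> {a..b}" for t
    using sf[OF that] by (simp add: L_def f_def algebra_simps)
  have Lnn: "0 \<le> L t $ j" if t: "t \<in> {a..b}" for t j
  proof -
    have "0 \<le> L t $ 1 * L t $ 2"
      using quad[OF t] sg by (auto simp: L_def mult.commute)
    then have "0 \<le> L t $ 1 \<and> 0 \<le> L t $ 2"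
      using Lsum[OF t] by (auto simp: zero_le_mult_iff)
    then show ?thesis using exhaust_2[of j] by auto
  qed
  \<comment> \<open>The kernel of \<open>L s\<close> composed with \<open>A i\<close> is the inverse
    image of direction \<open>s\<close>, which by invariance is again a direction \<open>t\<close>
    of the arc. Functionals with the same kernel are proportional; the factor is read off at the
    unit vector \<open>L t\<close> and is nonnegative since all entries are.\<close>
  have pull: "\<exists>t\<in>{a..b}. \<exists>\<mu>\<ge>0. \<forall>x. L s \<bullet> (A i *v x) = \<mu> * (L t \<bullet> x)"
    if i: "i \<in> {1..m}" and s: "s \<in> {a..b}" for i s
  proof -
    have "inv_action (A i) (direction (dir_vec s)) \<in> J"
      using J i s J_eq unfolding invariant_interval_def by blast
    then obtain t where t: "t \<in> {a..b}" "direction (matrix_inv (A i) *v dir_vec s) = direction (dir_vec t)"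
      using J_eq by (auto simp: inv_action_direction dir_vec_nonzero)
    have AA: "A i *v (matrix_inv (A i) *v x) = x" for x
      using someI_ex[OF inv[OF i, unfolded invertible_def]]
      by (simp add: matrix_vector_mul_assoc matrix_inv_def)
    have "matrix_inv (A i) *v dir_vec s \<noteq> 0"
      using AA[of "dir_vec s"] dir_vec_nonzero[of s] by auto
    then obtain k where k: "k \<noteq> 0" "matrix_inv (A i) *v dir_vec s = k *\<^sub>R dir_vec t"
      using direction_eqD[OF t(2)] dir_vec_nonzero by blast
    have "dir_vec s = k *\<^sub>R (A i *v dir_vec t)"
      using AA[of "dir_vec s"] k by (simp add: matrix_vector_mult_scaleR)
    moreover have "L s \<bullet> dir_vec s = 0" by (simp add: L_def inner_vec2)
    ultimately have z: "L s \<bullet> (A i *v dir_vec t) = 0" using k(1) by simp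
    have s2: "\<sigma> * \<sigma> = 1" using sg by auto
    define \<mu> where "\<mu> = L s \<bullet> (A i *v L t)"
    have "L s \<bullet> (A i *v x) = \<mu> * (L t \<bullet> x)" for x
    proof -
      have "A i *v x = (dir_vec t \<bullet> x) *\<^sub>R (A i *v dir_vec t) + (normal_vec t \<bullet> x) *\<^sub>R (A i *v normal_vec t)"
        by (subst frame_decomp[of x t])
           (simp only: matrix_vector_right_distrib matrix_vector_mult_scaleR)
      then have "L s \<bullet> (A i *v x) = (normal_vec t \<bullet> x) * (L s \<bullet> (A i *v normal_vec t))"
        using z by (simp add: inner_add_right)
      also have "\<dots> = (\<sigma> * \<sigma>) * \<dots>" using s2 by simp
      also have "\<dots> = \<mu> * (L t \<bullet> x)"
        unfolding \<mu>_def L_def by (simp add: matrix_vector_mult_scaleR)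
      finally show ?thesis .
    qed
    moreover have "0 \<le> \<mu>"
      unfolding \<mu>_def inner_vec2 mult_vec_2 using Lnn[OF s] Lnn[OF t(1)] pos[OF i]
      by (intro add_nonneg_nonneg mult_nonneg_nonneg) (auto simp: less_imp_le)
    ultimately show ?thesis using t by blast
  qed
  have comb: "\<exists>\<alpha>\<ge>0. \<exists>\<beta>\<ge>0. \<forall>x. L s \<bullet> (A i *v x) = \<alpha> * (L a \<bullet> x) + \<beta> * (L b \<bullet> x)"
    if i: "i \<in> {1..m}" and s: "s \<in> {a..b}" for i s
  proof -
    obtain t \<mu> where t: "t \<in> {a..b}" "0 \<le> \<mu>" "\<forall>x. L s \<bullet> (A i *v x) = \<mu> * (L t \<bullet> x)"
      using pull[OF i s] by blast
    obtain \<alpha> \<beta> where al: "0 \<le> \<alpha>" "0 \<le> \<beta>" "normal_vec t = \<alpha> *\<^sub>R normal_vec a + \<beta> *\<^sub>R normal_vec b"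
      using normal_vec_between[of a t b] t ab by auto
    have "L s \<bullet> (A i *v x) = (\<mu> * \<alpha>) * (L a \<bullet> x) + (\<mu> * \<beta>) * (L b \<bullet> x)" for x
      using t(3) by (simp add: L_def al(3) inner_add_left algebra_simps)
    then show ?thesis using al t by (intro exI[of _ "\<mu> * \<alpha>"] conjI exI[of _ "\<mu> * \<beta>"]) auto
  qed
  \<comment> \<open>Otherwise some normal of the arc annihilates \<open>u\<close>, so the direction
    of \<open>u\<close> lies both in \<open>J\<close> and among the difference directions.\<close>
  have "0 < (L a \<bullet> u) * (L b \<bullet> u)" if u: "u \<in> K" for u
  proof (rule ccontr)
    assume "\<not> 0 < (L a \<bullet> u) * (L b \<bullet> u)"
    moreover have "continuous_on {a..b} (\<lambda>t. L t \<bullet> u)"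
      unfolding L_def inner_vec2 by (simp, intro continuous_intros)
    ultimately obtain t where t: "t \<in> {a..b}" "L t \<bullet> u = 0"
      using ivt_zero[of a b "\<lambda>t. L t \<bullet> u"] ab by auto
    then have "normal_vec t \<bullet> u = 0" using sg by (auto simp: L_def)
    then have ue: "u = (dir_vec t \<bullet> u) *\<^sub>R dir_vec t" using frame_decomp[of u t] by simp
    have "u \<noteq> 0" using u K_nonzero by blast
    then have "direction u = direction (dir_vec t)"
      using ue direction_scaleR[of "dir_vec t \<bullet> u" "dir_vec t"] by (metis scaleR_zero_left)
    then have "direction u \<in> J" using t J_eq by blast
    moreover have "direction u \<in> difference_directions m T E"
      using u unfolding K_def difference_directions_def by blast
    ultimately show False using JS by blast
  qed
  then obtain c where c: "0 < c" "\<forall>w\<in>W. \<forall>u\<in>K. c * N w \<le> \<bar>(L a + L b) \<bullet> (P w *v u)\<bar>"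
    using cone_expansion[of "L a" "L b"] Lnn Lsum comb ab by auto
  have "L a + L b \<noteq> 0"
  proof
    assume "L a + L b = 0"
    then have "L a $ 1 + L b $ 1 = 0" "L a $ 2 + L b $ 2 = 0" by (metis vector_add_component zero_index)+
    then show False using Lsum[of a] Lsum[of b] ab by auto
  qed
  then show ?thesis using c by blast
qed

end

subsection \<open>Dimensions of the attractor\<close>

context positive_ifs begin

text \<open>A word longer than all words of \<open>S\<close> starts with one of them, since
  cylinders that meet are nested. Hence the sum \<open>a n\<close> over words of length at most
  \<open>n\<close> satisfies \<open>a n \<le> a L + a n / 2\<close>, and being finite it is at most
  \<open>2 * a L\<close>.\<close>

lemma renewal_bound:
  assumes fin: "finite S" and SW: "S \<subseteq> W" and cover: "E \<subseteq> (\<Union>w\<in>S. cyl w)"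
    and small: "(\<Sum>w\<in>S. N w powr t) \<le> 1/2"
    and t: "0 < t"
  shows "\<exists>B. \<forall>n. (\<Sum>w\<in>{w \<in> W. length w \<le> n}. N w powr t) \<le> B"
proof -
  define L where "L = Max (length ` S)"
  have L: "length w \<le> L" if "w \<in> S" for w unfolding L_def using fin that by auto
  let ?V = "\<lambda>n. {w \<in> W. length w \<le> n}"
  let ?f = "\<lambda>w. N w powr t"
  have split: "?V n \<subseteq> ?V L \<union> (\<lambda>(w, v). w @ v) ` (S \<times> ?V n)" for n
  proof
    fix v assume v: "v \<in> ?V n"
    show "v \<in> ?V L \<union> (\<lambda>(w, v). w @ v) ` (S \<times> ?V n)"
    proof (cases "length v \<le> L")
      case True then show ?thesis using v by auto
    next
      case False
      obtain x where x: "x \<in> cyl v" using E_ne by blast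
      have "x \<in> E" using x cyl_sub[of v] v by auto
      then obtain w where w: "w \<in> S" "x \<in> cyl w" using cover by blast
      have "length w \<le> length v" using L[OF w(1)] False by simp
      moreover have "w \<in> W" using w SW by blast
      ultimately have "take (length w) v = w"
        using cyl_meet_prefix[of w v] x w v by blast
      then have "v = w @ drop (length w) v" by (metis append_take_drop_id)
      moreover have "drop (length w) v \<in> ?V n"
        using v set_drop_subset[of "length w" v] by auto
      ultimately show ?thesis using w by (intro UnI2 image_eqI[of _ _ "(w, drop (length w) v)"]) auto
    qed
  qed
  have "sum ?f (?V n) \<le> 2 * sum ?f (?V L)" for n
  proof -
    have "sum ?f (?V n) \<le> sum ?f (?V L \<union> (\<lambda>(w, v). w @ v) ` (S \<times> ?V n))"
      using split finite_W fin by (intro sum_mono2) auto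
    also have "\<dots> \<le> sum ?f (?V L) + sum ?f ((\<lambda>(w, v). w @ v) ` (S \<times> ?V n))"
      using finite_W fin by (subst sum.union_inter[symmetric]) (auto intro!: sum_nonneg)
    also have "sum ?f ((\<lambda>(w, v). w @ v) ` (S \<times> ?V n)) \<le> (\<Sum>(w, v)\<in>S \<times> ?V n. ?f (w @ v))"
      using sum_image_le[of "S \<times> ?V n" ?f "\<lambda>(w, v). w @ v"] finite_W[of n] fin
      by (simp add: case_prod_unfold o_def)
    also have "\<dots> \<le> (\<Sum>(w, v)\<in>S \<times> ?V n. ?f w * ?f v)"
    proof (intro sum_mono, clarify)
      fix w v assume wv: "w \<in> S" "set v \<subseteq> {1..m}"
      then have "w \<in> W" "v \<in> W" using SW by auto
      then have "N (w @ v) powr t \<le> (N w * N v) powr t"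
        using t N_append N_pos[of "w @ v"] by (intro powr_mono2) (auto simp: less_imp_le)
      also have "\<dots> = N w powr t * N v powr t"
        by (rule powr_mult)
      finally show "N (w @ v) powr t \<le> N w powr t * N v powr t" .
    qed
    also have "\<dots> = (\<Sum>w\<in>S. ?f w) * sum ?f (?V n)"
      by (simp add: sum_product sum.cartesian_product)
    also have "\<dots> \<le> 1/2 * sum ?f (?V n)"
      using small by (intro mult_right_mono sum_nonneg) auto
    finally show ?thesis by simp
  qed
  then show ?thesis by blast
qed

section \<open>Words of bounded length and stopping words\<close>

lemma words_eq: "words m n = {w \<in> W. length w = n}"
  by (auto simp: words_def)

text \<open>Regroups by length. The empty word is left out because the series defining
  \<open>affinity_dim\<close> starts at length 1.\<close>

lemma sum_words_eq:
  "(\<Sum>n<k. \<Sum>w\<in>words m (Suc n). g w) = (\<Sum>w\<in>{w \<in> W. w \<noteq> [] \<and> length w \<le> k}. g w :: 'b::comm_monoid_add)"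
proof -
  let ?S = "{w \<in> W. w \<noteq> [] \<and> length w \<le> k}"
  have "finite ?S" using finite_W[of k] by (rule rev_finite_subset) auto
  moreover have "(\<lambda>w. length w - 1) ` ?S \<subseteq> {..<k}" by (auto simp: Suc_le_eq neq_Nil_conv)
  ultimately have "sum g ?S = (\<Sum>n<k. \<Sum>w\<in>{w \<in> ?S. length w - 1 = n}. g w)"
    using sum.group[of ?S "{..<k}" "\<lambda>w. length w - 1" g] by simp
  also have "\<dots> = (\<Sum>n<k. \<Sum>w\<in>words m (Suc n). g w)"
    by (intro sum.cong refl) (auto simp: words_eq simp flip: length_greater_0_conv)
  finally show ?thesis by simp
qed

lemma pressure_sum_finite:
  assumes t: "0 < t" and B: "\<forall>n. (\<Sum>w\<in>{w \<in> W. length w \<le> n}. N w powr t) \<le> B"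
  shows "(\<Sum>n. \<Sum>w\<in>words m (Suc n). ennreal (sv_function t (P w))) < \<infinity>"
proof -
  have "(\<Sum>n<k. \<Sum>w\<in>words m (Suc n). ennreal (sv_function t (P w))) \<le> ennreal B" for k
  proof -
    have "(\<Sum>n<k. \<Sum>w\<in>words m (Suc n). ennreal (sv_function t (P w)))
        = (\<Sum>w\<in>{w \<in> W. w \<noteq> [] \<and> length w \<le> k}. ennreal (sv_function t (P w)))"
      by (rule sum_words_eq)
    also have "\<dots> \<le> (\<Sum>w\<in>{w \<in> W. w \<noteq> [] \<and> length w \<le> k}. ennreal (N w powr t))"
      using t pos_P by (intro sum_mono ennreal_leI sv_function_le) auto
    also have "\<dots> = ennreal (\<Sum>w\<in>{w \<in> W. w \<noteq> [] \<and> length w \<le> k}. N w powr t)"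
      by (intro sum_ennreal) auto
    also have "\<dots> \<le> ennreal (\<Sum>w\<in>{w \<in> W. length w \<le> k}. N w powr t)"
      using finite_W by (intro ennreal_leI sum_mono2) auto
    also have "\<dots> \<le> ennreal B" using B by (intro ennreal_leI) auto
    finally show ?thesis .
  qed
  then have "(\<Sum>n. \<Sum>w\<in>words m (Suc n). ennreal (sv_function t (P w))) \<le> ennreal B"
    unfolding suminf_eq_SUP by (intro SUP_least)
  then show ?thesis by (metis ennreal_less_top infinity_ennreal_def order_le_less_trans)
qed

text \<open>Each point is coded by its first prefix with entry sum at most
  \<open>\<delta> / D\<close>. The cylinders of these words have diameter at most
  \<open>\<delta>\<close>, and each word contributes at least \<open>(g * \<delta>) powr s\<close>
  to a sum bounded by \<open>z\<close>, which bounds their number.\<close>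

lemma covering_number_le_pressure:
  assumes s: "0 < s" "s \<le> 1"
    and Z: "(\<Sum>n. \<Sum>w\<in>words m (Suc n). ennreal (sv_function s (P w))) < \<infinity>"
  shows "\<exists>C>0. \<forall>\<delta>. 0 < \<delta> \<and> \<delta> < 1 \<longrightarrow> real (covering_number \<delta> E) \<le> C * \<delta> powr (- s)"
proof -
  obtain z where z: "0 \<le> z" "(\<Sum>n. \<Sum>w\<in>words m (Suc n). ennreal (sv_function s (P w))) = ennreal z"
    using Z by (metis ennreal_cases infinity_ennreal_def less_irrefl)
  have fin_sum: "(\<Sum>w\<in>F. (N w / 4) powr s) \<le> z"
    if F: "F \<subseteq> {w \<in> W. w \<noteq> [] \<and> length w \<le> k}" for F k
  proof -
    have fin: "finite {w \<in> W. w \<noteq> [] \<and> length w \<le> k}"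
      using finite_W[of k] by (rule rev_finite_subset) auto
    have "ennreal (\<Sum>w\<in>F. (N w / 4) powr s) = (\<Sum>w\<in>F. ennreal ((N w / 4) powr s))"
      by (simp add: sum_ennreal)
    also have "\<dots> \<le> (\<Sum>w\<in>F. ennreal (sv_function s (P w)))"
      using s pos_P F by (intro sum_mono ennreal_leI sv_function_ge) auto
    also have "\<dots> \<le> (\<Sum>w\<in>{w \<in> W. w \<noteq> [] \<and> length w \<le> k}. ennreal (sv_function s (P w)))"
      using F fin by (intro sum_mono2) auto
    also have "\<dots> = (\<Sum>n<k. \<Sum>w\<in>words m (Suc n). ennreal (sv_function s (P w)))"
      by (rule sum_words_eq[symmetric])
    also have "\<dots> \<le> ennreal z"
      unfolding z(2)[symmetric] by (rule sum_le_suminf) auto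
    finally show ?thesis using z by simp
  qed
  obtain c where c: "0 < c" "\<forall>w\<in>W. \<forall>i\<in>{1..m}. c * N w \<le> N (w @ [i])"
    using N_snoc_ge by blast
  \<comment> \<open>The factor \<open>c\<close> pays for the last letter of a stopping word, 4 for
    passing from \<open>alpha1\<close> to the entry sum, and \<open>D\<close> for the size of
    \<open>E\<close>.\<close>
  define g where "g = c / (4 * D)"
  have g: "0 < g" using c D_pos by (simp add: g_def)
  have "real (covering_number \<delta> E) \<le> (z + 1) * g powr (- s) * \<delta> powr (- s)" if d: "0 < \<delta>" "\<delta> < 1" for \<delta>
  proof -
    \<comment> \<open>The empty word has entry sum 2, so the bound by 2 keeps it from being a
      stopping word and \<open>butlast\<close> is meaningful.\<close>
    have dD: "0 < \<delta> / D" "\<delta> / D < 2"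
    proof -
      show "0 < \<delta> / D" using d D_pos by simp
      have "1 \<le> D" using diameter_ge_0[OF compact_imp_bounded[OF E_compact]] by (simp add: D_def)
      then show "\<delta> / D < 2" using d by (simp add: field_simps)
    qed
    obtain n where n: "\<forall>w\<in>W. n \<le> length w \<longrightarrow> N w < \<delta> / D" using N_small[OF dD(1)] by blast
    define F where "F = {w \<in> W. w \<noteq> [] \<and> length w \<le> n \<and> N w \<le> \<delta> / D \<and> \<delta> / D < N (butlast w)}"
    have finF: "finite F" using finite_W[of n] by (rule rev_finite_subset) (auto simp: F_def)
    have "E \<subseteq> \<Union>(cyl ` F)"
    proof
      fix x assume "x \<in> E"
      then obtain w where w: "w \<in> W" "length w = n" "x \<in> cyl w" using E_cyl[of x n] by blast
      have takeW: "take k w \<in> W" for k using w(1) set_take_subset[of k w] by auto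
      define k where "k = (LEAST k. N (take k w) \<le> \<delta> / D)"
      have "N (take n w) \<le> \<delta> / D" using n w by (simp add: less_imp_le)
      then have k: "N (take k w) \<le> \<delta> / D" "k \<le> n"
        unfolding k_def by (auto intro: LeastI Least_le)
      have min: "\<delta> / D < N (take j w)" if "j < k" for j
        using not_less_Least[of j "\<lambda>k. N (take k w) \<le> \<delta> / D"] that by (auto simp: k_def)
      have "N (take 0 w) = 2" by (simp add: entry_sum_def mat_def)
      then have "k \<noteq> 0" using k dD by (metis not_less)
      have "butlast (take k w) = take (k - 1) w"
        using k w by (simp add: butlast_take)
      then have "take k w \<in> F"
        using takeW k min[of "k - 1"] \<open>k \<noteq> 0\<close> w by (auto simp: F_def)
      moreover have "drop k w \<in> W" using w(1) set_drop_subset[of k w] by auto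
      then have "x \<in> cyl (take k w)"
        using cyl_append_sub[of "drop k w" "take k w"] w by auto
      ultimately show "x \<in> \<Union>(cyl ` F)" by blast
    qed
    then have "covering_number \<delta> E \<le> card (cyl ` F)"
    proof (rule covering_number_le_card[rotated])
      fix U assume "U \<in> cyl ` F"
      then obtain w where w: "w \<in> F" "U = cyl w" by blast
      then have wW: "w \<in> W" "N w * D \<le> \<delta>" using D_pos by (auto simp: F_def field_simps)
      have "bounded U"
        using cyl_sub[OF wW(1)] w compact_imp_bounded[OF E_compact] bounded_subset by blast
      moreover have "diameter U \<le> \<delta>"
      proof (rule diameter_le_dist)
        fix x y assume "x \<in> U" "y \<in> U"
        then have "norm (x - y) \<le> N w * D" using cyl_dist[OF wW(1)] w by blast
        then show "dist x y \<le> \<delta>" using wW by (simp add: dist_norm)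
      qed (use d in simp)
      ultimately show "bounded U \<and> diameter U \<le> \<delta>" ..
    qed (use finF in simp)
    also have "card (cyl ` F) \<le> card F" by (rule card_image_le[OF finF])
    finally have "real (covering_number \<delta> E) * (g * \<delta>) powr s \<le> real (card F) * (g * \<delta>) powr s"
      by (intro mult_right_mono) auto
    also have "\<dots> = (\<Sum>w\<in>F. (g * \<delta>) powr s)" by simp
    also have "\<dots> \<le> (\<Sum>w\<in>F. (N w / 4) powr s)"
    proof (intro sum_mono powr_mono2)
      fix w assume w: "w \<in> F"
      then have "w = butlast w @ [last w]" "butlast w \<in> W" "last w \<in> {1..m}"
        using subsetD[OF _ last_in_set[of w], of "{1..m}"] by (auto simp: F_def dest: in_set_butlastD)
      then have "c * N (butlast w) \<le> N w" using c(2) by metis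
      moreover have "c * (\<delta> / D) \<le> c * N (butlast w)"
        using w c by (intro mult_left_mono) (auto simp: F_def)
      ultimately show "g * \<delta> \<le> N w / 4" by (simp add: g_def)
    qed (use s g d in auto)
    also have "\<dots> \<le> z" by (rule fin_sum[of F n]) (auto simp: F_def)
    finally have "real (covering_number \<delta> E) * (g powr s * \<delta> powr s) \<le> z + 1"
      using g d by (simp add: powr_mult)
    then show ?thesis using g d by (simp add: powr_minus field_simps)
  qed
  then show ?thesis using g z(1) by (intro exI[of _ "(z + 1) * g powr (- s)"]) auto
qed

end

text \<open>The disjointness of \<open>J\<close> from the difference directions enters below only
  through \<open>l\<close> and \<open>c\<close>.\<close>

locale separated_positive_ifs = positive_ifs +
  fixes l :: "real^2" and c :: real
  assumes l_nonzero: "l \<noteq> 0" and c_pos: "0 < c"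
    and expanding: "\<And>w u. w \<in> W \<Longrightarrow> u \<in> K \<Longrightarrow> c * N w \<le> \<bar>l \<bullet> (P w *v u)\<bar>"
begin

text \<open>With \<open>w\<close> the longest word whose cylinder contains both points,
  \<open>N w * D\<close> bounds their distance from above and \<open>c * N w\<close> bounds the
  variation of \<open>l\<close> from below.\<close>

lemma functional_lower:
  assumes "x \<in> E" "y \<in> E"
  shows "c * norm (x - y) \<le> D * \<bar>l \<bullet> (x - y)\<bar>"
proof (cases "x = y")
  case False
  obtain w x' y' u where w: "w \<in> W" "{x, y} \<subseteq> cyl w" "x' \<in> {x, y}" "y' \<in> {x, y}" "u \<in> K"
      "x' - y' = P w *v u"
    using first_separation[of "{x, y}" x y] assms False by blast
  have "c * N w \<le> \<bar>l \<bullet> (x' - y')\<bar>" using expanding w by metis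
  also have "\<dots> \<le> \<bar>l \<bullet> (x - y)\<bar>"
    using w(3,4) by (auto simp: inner_diff_right abs_minus_commute)
  finally have *: "c * N w \<le> \<bar>l \<bullet> (x - y)\<bar>" .
  have "c * norm (x - y) \<le> c * (N w * D)"
    using cyl_dist[OF w(1)] w(2) c_pos by (intro mult_left_mono) auto
  also have "\<dots> = D * (c * N w)" by simp
  also have "\<dots> \<le> D * \<bar>l \<bullet> (x - y)\<bar>" using * D_pos by (intro mult_left_mono) auto
  finally show ?thesis .
qed simp

text \<open>Allows arbitrary covering sets to be replaced by cylinders of comparable size.\<close>

lemma cylinder_of_small_set:
  assumes "U \<subseteq> E" "x0 \<in> U" "y0 \<in> U" "x0 \<noteq> y0"
  shows "\<exists>w\<in>W. U \<subseteq> cyl w \<and> c * N w \<le> norm l * diameter U"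
proof -
  obtain w x y u where w: "w \<in> W" "U \<subseteq> cyl w" "x \<in> U" "y \<in> U" "u \<in> K" "x - y = P w *v u"
    using first_separation[OF assms] by blast
  have "bounded U" using assms(1) E_compact bounded_subset compact_imp_bounded by blast
  then have "norm (x - y) \<le> diameter U"
    using diameter_bounded_bound[of U x y] w by (simp add: dist_norm)
  then have "norm l * norm (x - y) \<le> norm l * diameter U" by (intro mult_left_mono) auto
  moreover have "\<bar>l \<bullet> (x - y)\<bar> \<le> norm l * norm (x - y)" by (rule Cauchy_Schwarz_ineq2)
  moreover have "c * N w \<le> \<bar>l \<bullet> (x - y)\<bar>" using expanding w by metis
  ultimately show ?thesis using w by auto
qed

text \<open>By \<open>functional_lower\<close>, the projection of \<open>E\<close> to the line of
  \<open>l\<close> has a Lipschitz inverse, so the orthogonal coordinate is a Lipschitz function of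
  the projection and extends to the whole line.\<close>

lemma subset_lipschitz_curve: "\<exists>C. lipschitz_curve C \<and> E \<subseteq> C"
proof -
  define u where "u = sgn l"
  define v :: "real^2" where "v = vector [- u $ 2, u $ 1]"
  have v: "v $ 1 = - u $ 2" "v $ 2 = u $ 1" by (simp_all add: v_def)
  have u1: "norm u = 1" using l_nonzero by (simp add: u_def norm_sgn)
  then have uu: "u $ 1 * u $ 1 + u $ 2 * u $ 2 = 1"
    using norm_vec2_sq[of u] by (simp add: power2_eq_square)
  then have "(norm v)\<^sup>2 = 1" unfolding norm_vec2_sq v by (simp add: power2_eq_square)
  then have v1: "norm v = 1" using power2_eq_1_iff[of "norm v"] norm_ge_zero[of v] by linarith
  have uv: "u \<bullet> v = 0" by (simp add: inner_vec2 v)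
  have decomp: "x = (u \<bullet> x) *\<^sub>R u + (v \<bullet> x) *\<^sub>R v" for x
    using uu unfolding vec_eq_iff forall_2 inner_vec2 by (simp add: v) algebra
  define L where "L = D * norm l / c"
  have L: "0 \<le> L" using D_pos c_pos by (simp add: L_def)
  have low: "norm (x - y) \<le> L * \<bar>u \<bullet> x - u \<bullet> y\<bar>" if "x \<in> E" "y \<in> E" for x y
  proof -
    have "l \<bullet> (x - y) = norm l * (u \<bullet> x - u \<bullet> y)"
      using l_nonzero by (simp add: u_def sgn_div_norm inner_diff_right field_simps)
    then have "\<bar>l \<bullet> (x - y)\<bar> = norm l * \<bar>u \<bullet> x - u \<bullet> y\<bar>" by (simp only: abs_mult abs_norm_cancel)
    then have "c * norm (x - y) \<le> D * (norm l * \<bar>u \<bullet> x - u \<bullet> y\<bar>)"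
      using functional_lower[OF that] by (simp only:)
    then show ?thesis using c_pos by (simp add: L_def field_simps)
  qed
  have vlow: "v \<bullet> x - v \<bullet> y \<le> L * \<bar>u \<bullet> x - u \<bullet> y\<bar>" if "x \<in> E" "y \<in> E" for x y
  proof -
    have "\<bar>v \<bullet> (x - y)\<bar> \<le> norm v * norm (x - y)" by (rule Cauchy_Schwarz_ineq2)
    then show ?thesis using low[OF that] v1 by (simp add: inner_diff_right)
  qed
  \<comment> \<open>McShane extension of the partial function \<open>u \<bullet> x \<mapsto> v \<bullet> x\<close>.\<close>
  define f where "f t = (INF y\<in>E. v \<bullet> y + L * \<bar>t - u \<bullet> y\<bar>)" for t
  have bdd: "bdd_below ((\<lambda>y. v \<bullet> y + L * \<bar>t - u \<bullet> y\<bar>) ` E)" for t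
  proof -
    have "compact ((\<lambda>y. v \<bullet> y + L * \<bar>t - u \<bullet> y\<bar>) ` E)"
      by (intro compact_continuous_image E_compact continuous_intros)
    then show ?thesis by (intro bounded_imp_bdd_below compact_imp_bounded)
  qed
  \<comment> \<open>At a point of the projection the infimum is attained by \<open>x\<close> itself,
    by the Lipschitz bound \<open>vlow\<close>.\<close>
  have f_eq: "f (u \<bullet> x) = v \<bullet> x" if x: "x \<in> E" for x
    unfolding f_def
  proof (rule cInf_eq_minimum)
    show "v \<bullet> x \<in> (\<lambda>y. v \<bullet> y + L * \<bar>u \<bullet> x - u \<bullet> y\<bar>) ` E" using x by force
    show "v \<bullet> x \<le> a" if "a \<in> (\<lambda>y. v \<bullet> y + L * \<bar>u \<bullet> x - u \<bullet> y\<bar>) ` E" for a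
      using that vlow[OF x] by fastforce
  qed
  have f_le: "f s \<le> f t + L * \<bar>s - t\<bar>" for s t
  proof -
    have "f s - L * \<bar>s - t\<bar> \<le> f t"
      unfolding f_def[of t]
    proof (rule cINF_greatest[OF E_ne])
      fix y assume y: "y \<in> E"
      have "f s \<le> v \<bullet> y + L * \<bar>s - u \<bullet> y\<bar>"
        unfolding f_def by (rule cINF_lower[OF bdd y])
      also have "L * \<bar>s - u \<bullet> y\<bar> \<le> L * (\<bar>t - u \<bullet> y\<bar> + \<bar>s - t\<bar>)"
        using L by (intro mult_left_mono) auto
      finally show "f s - L * \<bar>s - t\<bar> \<le> v \<bullet> y + L * \<bar>t - u \<bullet> y\<bar>"
        by (simp add: algebra_simps)
    qed
    then show ?thesis by simp
  qed
  have "L-lipschitz_on UNIV f"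
  proof (rule lipschitz_onI[OF _ L])
    fix s t :: real
    show "dist (f s) (f t) \<le> L * dist s t"
      using f_le[of s t] f_le[of t s] by (simp add: dist_real_def abs_minus_commute abs_le_iff)
  qed
  then have "lipschitz_curve (range (\<lambda>t. t *\<^sub>R u + f t *\<^sub>R v))"
    unfolding lipschitz_curve_def using u1 v1 uv by blast
  moreover have "E \<subseteq> range (\<lambda>t. t *\<^sub>R u + f t *\<^sub>R v)"
  proof
    fix x assume "x \<in> E"
    then have "x = (u \<bullet> x) *\<^sub>R u + f (u \<bullet> x) *\<^sub>R v" using decomp f_eq by metis
    then show "x \<in> range (\<lambda>t. t *\<^sub>R u + f t *\<^sub>R v)" by blast
  qed
  ultimately show ?thesis by blast
qed

lemma covering_number_le_inverse:
  "\<exists>C>0. \<forall>\<delta>. 0 < \<delta> \<and> \<delta> < 1 \<longrightarrow> real (covering_number \<delta> E) \<le> C * \<delta> powr (- 1)"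
proof -
  obtain R where R: "\<forall>x\<in>E. norm x \<le> R" "0 < R"
    using compact_imp_bounded[OF E_compact] by (auto simp: bounded_pos)
  define M where "M = norm l * R"
  have M: "\<bar>l \<bullet> x\<bar> \<le> M" if "x \<in> E" for x
  proof -
    have "\<bar>l \<bullet> x\<bar> \<le> norm l * norm x" by (rule Cauchy_Schwarz_ineq2)
    also have "\<dots> \<le> M" unfolding M_def using R that by (intro mult_left_mono) auto
    finally show ?thesis .
  qed
  have M0: "0 \<le> M" unfolding M_def using R by simp
  have "real (covering_number \<delta> E) \<le> (2 * M * D / c + 2) * \<delta> powr (- 1)" if d: "0 < \<delta>" "\<delta> < 1" for \<delta>
  proof -
    \<comment> \<open>The width for which \<open>functional_lower\<close> gives slices of diameter
      at most \<open>\<delta>\<close>.\<close>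
    define h where "h = c * \<delta> / D"
    have h: "0 < h" using c_pos D_pos d by (simp add: h_def)
    define B where "B k = {x \<in> E. \<lfloor>l \<bullet> x / h\<rfloor> = k}" for k :: int
    define I where "I = {\<lfloor>- M / h\<rfloor>..\<lfloor>M / h\<rfloor>}"
    have "E \<subseteq> \<Union>(B ` I)"
    proof
      fix x assume x: "x \<in> E"
      have "- M / h \<le> l \<bullet> x / h" "l \<bullet> x / h \<le> M / h"
        using M[OF x] h divide_right_mono[of "- M" "l \<bullet> x" h] divide_right_mono[of "l \<bullet> x" M h] by auto
      then have "\<lfloor>l \<bullet> x / h\<rfloor> \<in> I" unfolding I_def by (auto intro: floor_mono)
      then show "x \<in> \<Union>(B ` I)" using x by (auto simp: B_def)
    qed
    then have "covering_number \<delta> E \<le> card (B ` I)"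
    proof (rule covering_number_le_card[rotated])
      fix U assume "U \<in> B ` I"
      then obtain k where k: "U = B k" by blast
      have "bounded U" unfolding k B_def
        using compact_imp_bounded[OF E_compact] by (rule bounded_subset) auto
      moreover have "diameter U \<le> \<delta>"
      proof (rule diameter_le_dist)
        fix x y assume "x \<in> U" "y \<in> U"
        then have xy: "x \<in> E" "y \<in> E" "\<lfloor>l \<bullet> x / h\<rfloor> = \<lfloor>l \<bullet> y / h\<rfloor>" by (auto simp: k B_def)
        then have "\<bar>l \<bullet> x / h - l \<bullet> y / h\<bar> < 1" by linarith
        then have "\<bar>l \<bullet> (x - y)\<bar> \<le> h"
          using h by (simp add: inner_diff_right diff_divide_distrib[symmetric] abs_divide)
        then have "D * \<bar>l \<bullet> (x - y)\<bar> \<le> c * \<delta>"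
          using D_pos by (simp add: h_def field_simps)
        then have "c * norm (x - y) \<le> c * \<delta>" using functional_lower[OF xy(1,2)] by linarith
        then show "dist x y \<le> \<delta>" using c_pos by (simp add: dist_norm)
      qed (use d in simp)
      ultimately show "bounded U \<and> diameter U \<le> \<delta>" ..
    qed (simp add: I_def)
    also have "\<dots> \<le> card I" by (rule card_image_le) (simp add: I_def)
    finally have "real (covering_number \<delta> E) \<le> real (card I)" by simp
    also have "\<dots> \<le> 2 * (M / h) + 2"
    proof -
      have "- M / h \<le> M / h" using M0 h by (intro divide_right_mono) auto
      then have "\<lfloor>- M / h\<rfloor> \<le> \<lfloor>M / h\<rfloor>" by (rule floor_mono)
      then have "real (card I) = real_of_int (\<lfloor>M / h\<rfloor> + 1 - \<lfloor>- M / h\<rfloor>)"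
        by (simp add: I_def)
      also have "\<dots> \<le> 2 * (M / h) + 2" by linarith
      finally show ?thesis .
    qed
    \<comment> \<open>The additive 2 is absorbed because \<open>\<delta> < 1\<close>.\<close>
    also have "\<dots> \<le> (2 * M * D / c + 2) / \<delta>"
      using d c_pos D_pos by (simp add: h_def field_simps)
    finally show ?thesis using d by (simp add: powr_minus_divide)
  qed
  moreover have "0 < 2 * M * D / c + 2" using M0 D_pos c_pos by (intro add_nonneg_pos) auto
  ultimately show ?thesis by blast
qed

text \<open>Its complement in \<open>E\<close> is the union of the finitely many other cylinders of
  the same length, which are compact and disjoint from it.\<close>

lemma cyl_relatively_open:
  assumes "w \<in> W"
  shows "\<exists>O'. open O' \<and> cyl w = E \<inter> O'"
proof -
  let ?V = "{v \<in> W. length v = length w \<and> v \<noteq> w}"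
  have fin: "finite ?V" using finite_W[of "length w"] by (rule rev_finite_subset) auto
  have cont: "continuous_on S (word_map T v)" if "v \<in> W" for S v
    using that
  proof (induction v)
    case (Cons i v)
    then have "continuous_on S (\<lambda>x. A i *v word_map T v x + d i)"
      using Cons by (intro continuous_intros
          bounded_linear.continuous_on[OF matrix_vector_mul_bounded_linear]) auto
    moreover have "(\<lambda>x. A i *v word_map T v x + d i) = word_map T (i # v)"
      using Cons T_eq by auto
    ultimately show ?case by (simp only:)
  next
    case Nil
    have "word_map T [] = id" by auto
    then show ?case by (simp add: id_def)
  qed
  have "closed (cyl v)" if "v \<in> W" for v
    using cont[OF that] E_compact by (intro compact_imp_closed compact_continuous_image)
  then have "closed (\<Union>v\<in>?V. cyl v)" using fin by (intro closed_UN) auto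
  moreover have "cyl w = E \<inter> - (\<Union>v\<in>?V. cyl v)"
  proof
    have "cyl w \<inter> cyl v = {}" if "v \<in> ?V" for v
      using cyl_meet_prefix[of w v] assms that by auto
    then show "cyl w \<subseteq> E \<inter> - (\<Union>v\<in>?V. cyl v)" using cyl_sub[OF assms] by blast
    show "E \<inter> - (\<Union>v\<in>?V. cyl v) \<subseteq> cyl w"
    proof
      fix x assume x: "x \<in> E \<inter> - (\<Union>v\<in>?V. cyl v)"
      then obtain v where "v \<in> W" "length v = length w" "x \<in> cyl v" using E_cyl[of x] by blast
      then show "x \<in> cyl w" using x by blast
    qed
  qed
  ultimately show ?thesis by (intro exI conjI) (rule open_Compl)
qed

text \<open>Each set of an efficient cover is replaced by a cylinder, with total weight at most 1/4
  from the diameters and 1/4 from the error terms. Cylinders are relatively open, so compactness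
  leaves finitely many.\<close>

lemma small_cylinder_cover:
  assumes t: "0 < t" and H: "hausdorff_measure t E = 0"
  shows "\<exists>S. finite S \<and> S \<subseteq> W \<and> E \<subseteq> (\<Union>w\<in>S. cyl w) \<and> (\<Sum>w\<in>S. N w powr t) \<le> 1/2"
proof -
  define q where "q = (norm l / c) powr t"
  have q: "0 < q" using l_nonzero c_pos by (simp add: q_def)
  have "hausdorff_premeasure t 1 E \<le> hausdorff_measure t E"
    unfolding hausdorff_measure_def by (intro SUP_upper) auto
  also have "\<dots> < ennreal (1 / (4 * q))" using H q by simp
  finally obtain U where U: "E \<subseteq> (\<Union>n. U n)" "\<And>n. bounded (U n)"
      "(\<Sum>n. ennreal (diameter (U n) powr t)) < ennreal (1 / (4 * q))"
    unfolding hausdorff_premeasure_def INF_less_iff by blast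
  have "\<exists>w\<in>W. U n \<inter> E \<subseteq> cyl w \<and> N w powr t \<le> q * diameter (U n) powr t + (1/2) ^ (n + 3)" for n
  proof (cases "\<exists>x0 y0. x0 \<in> U n \<inter> E \<and> y0 \<in> U n \<inter> E \<and> x0 \<noteq> y0")
    case True
    then obtain w where w: "w \<in> W" "U n \<inter> E \<subseteq> cyl w" "c * N w \<le> norm l * diameter (U n \<inter> E)"
      using cylinder_of_small_set[of "U n \<inter> E"] by blast
    have "diameter (U n \<inter> E) \<le> diameter (U n)" using U(2) by (intro diameter_subset) auto
    then have "norm l * diameter (U n \<inter> E) \<le> norm l * diameter (U n)" by (intro mult_left_mono) auto
    then have "N w \<le> norm l / c * diameter (U n)" using w(3) c_pos by (simp add: field_simps)
    then have "N w powr t \<le> (norm l / c * diameter (U n)) powr t"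
      using t N_pos[OF w(1)] by (intro powr_mono2) auto
    also have "\<dots> = q * diameter (U n) powr t"
      unfolding q_def by (rule powr_mult)
    finally have "N w powr t \<le> q * diameter (U n) powr t + (1/2) ^ (n + 3)"
      by (rule order_trans) simp
    then show ?thesis using w by blast
  next
    \<comment> \<open>A set with at most one point in \<open>E\<close> may have diameter 0, so a
      deep cylinder around that point is taken, of weight at most the error term; if the
      intersection is empty, any point of \<open>E\<close> will do.\<close>
    case False
    then obtain x where x: "x \<in> E" "U n \<inter> E \<subseteq> {x}" using E_ne by blast
    define e where "e = ((1/2) ^ (n + 3)) powr (1 / t)"
    have e: "0 < e" "e powr t = (1/2) ^ (n + 3)" using t by (simp_all add: e_def powr_powr)
    obtain k where k: "\<forall>w\<in>W. k \<le> length w \<longrightarrow> N w < e" using N_small[OF e(1)] by blast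
    obtain w where w: "w \<in> W" "length w = k" "x \<in> cyl w" using E_cyl[OF x(1), of k] by blast
    have "N w powr t \<le> e powr t" using k w t N_pos[OF w(1)] by (intro powr_mono2) (auto simp: less_imp_le)
    also have "\<dots> \<le> q * diameter (U n) powr t + (1/2) ^ (n + 3)" unfolding e(2) using q by simp
    finally show ?thesis using w x by blast
  qed
  then obtain wk where wk: "\<And>n. wk n \<in> W" "\<And>n. U n \<inter> E \<subseteq> cyl (wk n)"
      "\<And>n. N (wk n) powr t \<le> q * diameter (U n) powr t + (1/2) ^ (n + 3)"
    by metis
  obtain O' where O': "\<And>n. open (O' n)" "\<And>n. cyl (wk n) = E \<inter> O' n"
    using cyl_relatively_open[OF wk(1)] by metis
  have "E \<subseteq> (\<Union>n\<in>UNIV. O' n)"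
  proof
    fix x assume x: "x \<in> E"
    then obtain n where "x \<in> U n" using U(1) by blast
    then have "x \<in> cyl (wk n)" using x wk(2)[of n] by blast
    then show "x \<in> (\<Union>n\<in>UNIV. O' n)" unfolding O'(2) by blast
  qed
  then obtain I where I: "finite I" "E \<subseteq> (\<Union>n\<in>I. O' n)"
    using compactE_image[OF E_compact, of UNIV O'] O'(1) by metis
  have "(\<Sum>w\<in>wk ` I. N w powr t) \<le> (\<Sum>n\<in>I. N (wk n) powr t)"
    using sum_image_le[of I "\<lambda>w. N w powr t" wk] I by (simp add: o_def)
  also have "\<dots> \<le> (\<Sum>n\<in>I. q * diameter (U n) powr t + (1/2) ^ (n + 3))"
    by (intro sum_mono wk(3))
  also have "\<dots> = q * (\<Sum>n\<in>I. diameter (U n) powr t) + (\<Sum>n\<in>I. (1/2) ^ (n + 3))"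
    by (simp add: sum.distrib sum_distrib_left)
  also have "\<dots> \<le> q * (1 / (4 * q)) + 1/4"
  proof (intro add_mono mult_left_mono)
    have "ennreal (\<Sum>n\<in>I. diameter (U n) powr t) = (\<Sum>n\<in>I. ennreal (diameter (U n) powr t))"
      by (simp add: sum_ennreal)
    also have "\<dots> \<le> (\<Sum>n. ennreal (diameter (U n) powr t))"
      using I by (intro sum_le_suminf) auto
    also have "\<dots> \<le> ennreal (1 / (4 * q))" using U(3) by simp
    finally show "(\<Sum>n\<in>I. diameter (U n) powr t) \<le> 1 / (4 * q)"
      using q by (simp add: ennreal_le_iff)
    have geo: "(\<lambda>n. (1/2::real) ^ (n + 3)) sums (1/4)"
      using sums_mult[OF geometric_sums[of "1/2::real"], of "1/8"] by (simp add: power_add eval_nat_numeral)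
    have "(\<Sum>n\<in>I. (1/2::real) ^ (n + 3)) \<le> (\<Sum>n. (1/2) ^ (n + 3))"
      using geo I by (intro sum_le_suminf sums_summable[OF geo]) auto
    then show "(\<Sum>n\<in>I. (1/2::real) ^ (n + 3)) \<le> 1/4" using sums_unique[OF geo] by simp
  qed (use q in simp)
  also have "\<dots> = 1/2" using q by simp
  finally show ?thesis
    using I wk(1) O'(2) by (intro exI[of _ "wk ` I"]) auto
qed

text \<open>Null measure gives a finite cylinder cover of weight at most 1/2, and the renewal
  inequality then makes the series converge. This takes the place of constructing a measure on
  \<open>E\<close>.\<close>

lemma affinity_dim_le_hausdorff_dim: "affinity_dim m A \<le> hausdorff_dim E"
  unfolding hausdorff_dim_def
proof (rule INF_greatest)
  fix t assume "t \<in> {s. 0 < s \<and> hausdorff_measure s E = 0}"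
  then have t: "0 < t" "hausdorff_measure t E = 0" by auto
  obtain S where S: "finite S" "S \<subseteq> W" "E \<subseteq> (\<Union>w\<in>S. cyl w)" "(\<Sum>w\<in>S. N w powr t) \<le> 1/2"
    using small_cylinder_cover[OF t] by (elim exE conjE) (rule that)
  obtain B where B: "\<forall>n. (\<Sum>w\<in>{w \<in> W. length w \<le> n}. N w powr t) \<le> B"
    using renewal_bound[OF S t(1)] by (elim exE) (rule that)
  have "(\<Sum>n. \<Sum>w\<in>words m (Suc n). ennreal (sv_function t (P w))) < \<infinity>"
    by (rule pressure_sum_finite[OF t(1) B])
  then show "affinity_dim m A \<le> ereal t"
    unfolding affinity_dim_def using t by (intro INF_lower) auto
qed

text \<open>Up to exponent 1 the stopping words give the bound; above 1,
  \<open>\<delta> powr (- 1)\<close> is already smaller than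
  \<open>\<delta> powr (- s)\<close>.\<close>

lemma covering_number_bound:
  assumes "0 < s" "(\<Sum>n. \<Sum>w\<in>words m (Suc n). ennreal (sv_function s (P w))) < \<infinity>"
  shows "\<exists>C>0. \<forall>\<^sub>F \<delta> in at_right 0. real (covering_number \<delta> E) \<le> C * \<delta> powr (- s)"
proof -
  have "\<exists>C>0. \<forall>\<delta>. 0 < \<delta> \<and> \<delta> < 1 \<longrightarrow> real (covering_number \<delta> E) \<le> C * \<delta> powr (- s)"
  proof (cases "s \<le> 1")
    case True then show ?thesis using covering_number_le_pressure[OF assms(1) _ assms(2)] by simp
  next
    case False
    obtain C where C: "0 < C" "\<forall>\<delta>. 0 < \<delta> \<and> \<delta> < 1 \<longrightarrow> real (covering_number \<delta> E) \<le> C * \<delta> powr (- 1)"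
      using covering_number_le_inverse by blast
    have "real (covering_number \<delta> E) \<le> C * \<delta> powr (- s)" if "0 < \<delta>" "\<delta> < 1" for \<delta>
    proof -
      have "\<delta> powr (- 1) \<le> \<delta> powr (- s)" using that False by (intro powr_mono') auto
      then have "C * \<delta> powr (- 1) \<le> C * \<delta> powr (- s)" using C by (intro mult_left_mono) auto
      then show ?thesis using C(2) that by force
    qed
    then show ?thesis using C(1) by blast
  qed
  then obtain C where C: "0 < C"
    "\<And>\<delta>. 0 < \<delta> \<and> \<delta> < 1 \<Longrightarrow> real (covering_number \<delta> E) \<le> C * \<delta> powr (- s)"
    by blast
  have "\<forall>\<^sub>F \<delta> in at_right (0::real). 0 < \<delta> \<and> \<delta> < 1"
    by (auto simp: eventually_at_right_field intro!: exI[of _ 1])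
  then have "\<forall>\<^sub>F \<delta> in at_right 0. real (covering_number \<delta> E) \<le> C * \<delta> powr (- s)"
    by (rule eventually_mono) (rule C(2))
  with C(1) show ?thesis by (intro exI conjI)
qed

section \<open>Equality of the dimensions\<close>

lemma hausdorff_dim_eq: "hausdorff_dim E = affinity_dim m A"
proof (rule antisym[OF _ affinity_dim_le_hausdorff_dim])
  show "hausdorff_dim E \<le> affinity_dim m A"
    unfolding affinity_dim_def
  proof (rule INF_greatest)
    fix s assume "s \<in> {s. 0 < s \<and> (\<Sum>n. \<Sum>w\<in>words m (Suc n). ennreal (sv_function s (P w))) < \<infinity>}"
    then have s: "0 < s" "(\<Sum>n. \<Sum>w\<in>words m (Suc n). ennreal (sv_function s (P w))) < \<infinity>" by auto
    obtain C where C: "\<forall>\<^sub>F \<delta> in at_right 0. real (covering_number \<delta> E) \<le> C * \<delta> powr (- s)"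
      using covering_number_bound[OF s] by blast
    show "hausdorff_dim E \<le> ereal s"
    \<comment> \<open>At \<open>s\<close> itself the covering bound only controls the measure by a
      constant; the margin \<open>e\<close> makes it vanish.\<close>
    proof (rule ereal_le_epsilon2)
      fix e :: real assume e: "0 < e"
      have "hausdorff_measure (s + e) E = 0"
        using eventually_frequently[of "at_right (0::real)", OF _ C] e s(1)
        by (intro hausdorff_measure_eq_0I[OF E_compact, of s _ C]) auto
      then show "hausdorff_dim E \<le> ereal s + ereal e"
        unfolding hausdorff_dim_def using s e by (auto intro!: INF_lower2[of "s + e"])
    qed
  qed
qed

text \<open>The upper half is the covering bound. For the lower half, covering numbers that are too
  small at arbitrarily small scales would push the Hausdorff dimension below the affinity
  dimension.\<close>

lemma box_dim: "has_box_dim E (affinity_dim m A)"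
  unfolding has_box_dim_def
proof (rule order_tendstoI)
  let ?r = "\<lambda>\<delta>. ln (real (covering_number \<delta> E)) / - ln \<delta>"
  have ev01: "\<forall>\<^sub>F \<delta> in at_right (0::real). 0 < \<delta> \<and> \<delta> < 1"
    by (auto simp: eventually_at_right_field intro!: exI[of _ 1])
  fix a assume a: "a < affinity_dim m A"
  show "\<forall>\<^sub>F \<delta> in at_right 0. a < ereal (?r \<delta>)"
  proof (cases "a < 0")
    case True
    show ?thesis using ev01
    proof eventually_elim
      case (elim \<delta>)
      then have "0 \<le> ?r \<delta>"
        using covering_number_pos[OF E_compact E_ne, of \<delta>] by (intro divide_nonneg_pos) auto
      then have "0 \<le> ereal (?r \<delta>)" by simp
      with True show ?case by (rule order.strict_trans2)
    qed
  next
    case False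
    \<comment> \<open>Here \<open>a\<close> is nonnegative, so \<open>t\<close> is positive. The
      second exponent \<open>t'\<close> is needed because measure zero follows only strictly above
      \<open>t\<close>.\<close>
    obtain t where t: "a < ereal t" "ereal t < affinity_dim m A" using a ereal_dense2 by blast
    obtain t' where t': "ereal t < ereal t'" "ereal t' < affinity_dim m A" using t ereal_dense2 by blast
    have t0: "0 < t" using False t(1) by (metis ereal_less(2) not_less order_le_less_trans)
    show ?thesis
    proof (rule ccontr)
      assume "\<not> ?thesis"
      then have "\<exists>\<^sub>F \<delta> in at_right 0. \<not> a < ereal (?r \<delta>)" by (simp add: not_eventually)
      then have "\<exists>\<^sub>F \<delta> in at_right 0. real (covering_number \<delta> E) \<le> 1 * \<delta> powr (- t)"
      proof (rule frequently_rev_mp[OF _ eventually_mono[OF ev01]], intro impI)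
        fix \<delta> :: real assume d: "0 < \<delta> \<and> \<delta> < 1" and r: "\<not> a < ereal (?r \<delta>)"
        then have "ereal (?r \<delta>) < ereal t" using t(1) by (meson not_less order_le_less_trans)
        then show "real (covering_number \<delta> E) \<le> 1 * \<delta> powr (- t)"
          using covering_number_le_of_ratio[of \<delta> E t] d covering_number_pos[OF E_compact E_ne, of \<delta>] by simp
      qed
      then have "hausdorff_measure t' E = 0"
        using t0 t' by (intro hausdorff_measure_eq_0I[OF E_compact, of t t' 1]) auto
      then have "hausdorff_dim E \<le> ereal t'"
        unfolding hausdorff_dim_def using t0 t' by (intro INF_lower) auto
      then show False using t'(2) hausdorff_dim_eq by simp
    qed
  qed
next
  fix a assume "affinity_dim m A < a"
  then obtain s where s: "0 < s" "(\<Sum>n. \<Sum>w\<in>words m (Suc n). ennreal (sv_function s (P w))) < \<infinity>" "ereal s < a"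
    unfolding affinity_dim_def INF_less_iff by auto
  obtain s' where s': "ereal s < ereal s'" "ereal s' < a" using s(3) ereal_dense2 by blast
  obtain C where C: "0 < C" "\<forall>\<^sub>F \<delta> in at_right 0. real (covering_number \<delta> E) \<le> C * \<delta> powr (- s)"
    using covering_number_bound[OF s(1,2)] by blast
  have "\<forall>\<^sub>F \<delta> in at_right 0. ln (real (covering_number \<delta> E)) / - ln \<delta> < s'"
    using C s' by (intro box_ratio_upper[OF E_compact E_ne, of C s]) auto
  then show "\<forall>\<^sub>F \<delta> in at_right 0. ereal (ln (real (covering_number \<delta> E)) / - ln \<delta>) < a"
  proof (rule eventually_mono)
    fix \<delta> :: real assume "ln (real (covering_number \<delta> E)) / - ln \<delta> < s'"
    then have "ereal (ln (real (covering_number \<delta> E)) / - ln \<delta>) < ereal s'" by simp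
    then show "ereal (ln (real (covering_number \<delta> E)) / - ln \<delta>) < a" using s'(2) by (rule less_trans)
  qed
qed

end

theorem proposition5:
  fixes m :: nat
    and A :: "nat \<Rightarrow> real^2^2"
    and d :: "nat \<Rightarrow> real^2"
    and T :: "nat \<Rightarrow> real^2 \<Rightarrow> real^2"
    and E :: "(real^2) set"
    and J :: "(real^2) set set"
  assumes "1 \<le> m"
    and "\<And>i x. i \<in> {1..m} \<Longrightarrow> T i x = A i *v x + d i"
    and "\<And>i. i \<in> {1..m} \<Longrightarrow> invertible (A i)"
    and "\<And>i j k. i \<in> {1..m} \<Longrightarrow> 0 < A i $ j $ k"
    and "\<And>i. i \<in> {1..m} \<Longrightarrow> onorm (\<lambda>x. A i *v x) < 1"
    and "is_attractor m T E"
    and "disjoint_family_on (\<lambda>i. T i ` E) {1..m}"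
    and "minimal_invariant_interval m A J"
    and "J \<inter> difference_directions m T E = {}"
  shows "(\<exists>C. lipschitz_curve C \<and> E \<subseteq> C) \<and>
         hausdorff_dim E = affinity_dim m A \<and>
         has_box_dim E (affinity_dim m A)"
proof -
  interpret positive_ifs m A d T E
    using assms(1-7) by unfold_locales
  have "invariant_interval m A J"
    using assms(8) by (simp add: minimal_invariant_interval_def)
  then obtain l c where lc: "l \<noteq> 0" "0 < c" "\<forall>w\<in>W. \<forall>u\<in>K. c * N w \<le> \<bar>l \<bullet> (P w *v u)\<bar>"
    using expanding_functional[OF _ assms(9)] by blast
  interpret separated_positive_ifs m A d T E l c
    using lc by unfold_locales auto
  show ?thesis
    using subset_lipschitz_curve hausdorff_dim_eq box_dim by blast
qed

end
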